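(* There is a constant $C$, independent of $u$, such that the following holds. Let $u:U\subset\mathbb{R}^3\to\mathbb{R}$ be an axisymmetric function such that, as a function of $(r,z)$, $u\in BV(\Omega)\cap L^\infty(\Omega)$ and $\operatorname{supp}(u)\subset[0,1)\times[-1,1]$. If $\mathcal{A}u=f$, then $$\|u\|_{L^2(U)}\le C\,\|u\|_{L^\infty(\Omega)}^{1/3}\,\|u\|_{TV(\Omega)}^{1/3}\,\|f\|_{L^2(\Omega)}^{1/3}.$$
   Context: $\Omega=[0,1]\times[-1,1]\subset\mathbb{R}^2$ and $U=\{(x,y)\in\mathbb{R}^2:x^2+y^2\le1\}\times[-1,1]\subset\mathbb{R}^3$. A function $u$ on $U$ is axisymmetric if it depends only on $r=\sqrt{x^2+y^2}$ and $z$; it is then also written $u(r,z)$, $(r,z)\in\Omega$, and it is extended by zero for $r\ge1$. The Abel transform of $u$ is $$\mathcal{A}u(x,z):=2\int_x^\infty\frac{u(r,z)\,r}{\sqrt{r^2-x^2}}\,dr,\qquad (x,z)\in[0,\infty)\times\mathbb{R}.$$ The norm on the left is $\|u\|_{L^2(U)}:=\left(\int_{-1}^1\iint_{B(0,1)}|u(x,y,z)|^2\,dx\,dy\,dz\right)^{1/2}$, with $B(0,1)$ the unit ball of $\mathbb{R}^2$. The total variation with respect to $(r,z)$ is $$\|u\|_{TV(\Omega)}:=\sup\left\{\iint_\Omega u(r,z)\,\operatorname{div}\phi(r,z)\,dr\,dz:\ \phi\in C_c^1((0,1)\times(-1,1);\mathbb{R}^2),\ \|\phi\|_{L^\infty(\Omega)}\le1\right\},$$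 where $\operatorname{div}$ is taken in the variables $(r,z)$. Spaces such as $BV(\Omega)$ are understood on the interior of $\Omega$. *)

theory Defs
  imports "HOL-Analysis.Analysis" "HOL-Probability.Essential_Supremum"
begin

definition Omega :: "(real \<times> real) set" where
  "Omega = {0..1} \<times> {-1..1}"

definition cylinder :: "(real \<times> real \<times> real) set" where
  "cylinder = {(x, y, z). x\<^sup>2 + y\<^sup>2 \<le> 1 \<and> z \<in> {-1..1}}"

definition axisymmetric :: "(real \<times> real \<times> real \<Rightarrow> real) \<Rightarrow> bool" where
  "axisymmetric u \<longleftrightarrow>
     (\<exists>h. \<forall>(x, y, z)\<in>cylinder. u (x, y, z) = h (sqrt (x\<^sup>2 + y\<^sup>2), z))"

text \<open>The function \<open>u(r,z)\<close> belonging to an axisymmetric \<open>u\<close>: its values on the half-plane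
  \<open>y = 0\<close>, \<open>x = r \<ge> 0\<close>, extended by zero for \<open>r \<ge> 1\<close>. Values outside \<open>Omega\<close> other than this
  extension are never used.\<close>

definition profile :: "(real \<times> real \<times> real \<Rightarrow> real) \<Rightarrow> real \<times> real \<Rightarrow> real" where
  "profile u = (\<lambda>(r, z). if r \<in> {0..<1} \<and> z \<in> {-1..1} then u (r, 0, z) else 0)"

definition abel :: "(real \<times> real \<Rightarrow> real) \<Rightarrow> real \<times> real \<Rightarrow> real" where
  "abel g = (\<lambda>(x, z). 2 * (LINT r:{x<..}|lebesgue. g (r, z) * r / sqrt (r\<^sup>2 - x\<^sup>2)))"

definition L2_on :: "'a::euclidean_space set \<Rightarrow> ('a \<Rightarrow> real) \<Rightarrow> bool" where
  "L2_on S f \<longleftrightarrow> f \<in> borel_measurable (lebesgue_on S) \<and>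
     integrable (lebesgue_on S) (\<lambda>p. \<bar>f p\<bar>\<^sup>2)"

definition L2_norm :: "'a::euclidean_space set \<Rightarrow> ('a \<Rightarrow> real) \<Rightarrow> real" where
  "L2_norm S f = sqrt (LINT p|lebesgue_on S. \<bar>f p\<bar>\<^sup>2)"

definition Linf_enorm ::
    "'a::euclidean_space set \<Rightarrow> ('a \<Rightarrow> 'b::euclidean_space) \<Rightarrow> ereal" where
  "Linf_enorm S f = esssup (lebesgue_on S) (\<lambda>p. ereal (norm (f p)))"

definition Linf_on :: "'a::euclidean_space set \<Rightarrow> ('a \<Rightarrow> 'b::euclidean_space) \<Rightarrow> bool" where
  "Linf_on S f \<longleftrightarrow> f \<in> borel_measurable (lebesgue_on S) \<and> Linf_enorm S f < \<infinity>"

definition Linf_norm :: "'a::euclidean_space set \<Rightarrow> ('a \<Rightarrow> 'b::euclidean_space) \<Rightarrow> real" where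
  "Linf_norm S f = real_of_ereal (Linf_enorm S f)"

text \<open>Compactly supported \<open>C\<^sup>1\<close> fields on an open set \<open>W\<close>, taken as fields on the whole plane
  that vanish outside a compact subset of \<open>W\<close>.\<close>

definition C1_compact_support ::
    "(real \<times> real) set \<Rightarrow> (real \<times> real \<Rightarrow> real \<times> real) set" where
  "C1_compact_support W = {\<phi>.
     (\<exists>\<phi>' :: real \<times> real \<Rightarrow> (real \<times> real) \<Rightarrow>\<^sub>L (real \<times> real).
        (\<forall>p. (\<phi> has_derivative blinfun_apply (\<phi>' p)) (at p)) \<and> continuous_on UNIV \<phi>') \<and>
     compact (closure {p. \<phi> p \<noteq> 0}) \<and> closure {p. \<phi> p \<noteq> 0} \<subseteq> W}"

definition divergence :: "(real \<times> real \<Rightarrow> real \<times> real) \<Rightarrow> real \<times> real \<Rightarrow> real" where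
  "divergence \<phi> p =
     fst (frechet_derivative \<phi> (at p) (1, 0)) + snd (frechet_derivative \<phi> (at p) (0, 1))"

definition TV_enorm :: "(real \<times> real \<Rightarrow> real) \<Rightarrow> ereal" where
  "TV_enorm g =
     (SUP \<phi> \<in> {\<phi> \<in> C1_compact_support ({0<..<1} \<times> {-1<..<1}). Linf_enorm Omega \<phi> \<le> 1}.
        ereal (LINT p|lebesgue_on Omega. g p * divergence \<phi> p))"

definition TV_norm :: "(real \<times> real \<Rightarrow> real) \<Rightarrow> real" where
  "TV_norm g = real_of_ereal (TV_enorm g)"

definition BV_Omega :: "(real \<times> real \<Rightarrow> real) \<Rightarrow> bool" where
  "BV_Omega g \<longleftrightarrow> integrable (lebesgue_on (interior Omega)) g \<and> TV_enorm g < \<infinity>"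

text \<open>Support of an a.e. equivalence class, as a relatively closed subset of \<open>S\<close>: the complement
  in \<open>S\<close> of the largest relatively open set on which \<open>g\<close> vanishes almost everywhere. It is
  contained in the closure of \<open>{p. g p \<noteq> 0}\<close>.\<close>

definition ess_support :: "'a::euclidean_space set \<Rightarrow> ('a \<Rightarrow> real) \<Rightarrow> 'a set" where
  "ess_support S g =
     {p \<in> S. \<forall>V. open V \<and> p \<in> V \<longrightarrow> \<not> (AE q in lebesgue_on S. q \<in> V \<longrightarrow> g q = 0)}"

end

theory Submission
  imports Defs
begin

text \<open>The estimate is an interpolation between a negative and a positive order of smoothness, and it
  becomes transparent in the variable \<open>s = r\<^sup>2\<close>. Write \<open>v (s, z) = u (sqrt s, z)\<close>, let \<open>M\<close> be the
  supremum norm and \<open>T\<close> the total variation. Three things happen under this substitution: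
  the area element of the disc becomes constant, so the squared \<open>L\<^sup>2\<close> norm of \<open>u\<close> over the cylinder
  is \<open>pi\<close> times that of \<open>v\<close>; the Abel transform becomes the half-order fractional integral
  \<open>F t = \<integral>\<^bsub>s > t\<^esub> v s / sqrt (s - t)\<close> evaluated at \<open>t = x\<^sup>2\<close>; and the variation in the radial
  direction does not change.

  Compare \<open>v\<close> with its average \<open>v\<^sub>h\<close> over intervals of length \<open>h\<close> in \<open>s\<close>. Since \<open>v\<close> is bounded by
  \<open>M\<close>, the pairing of \<open>v\<close> with \<open>v - v\<^sub>h\<close> is at most \<open>M\<close> times the \<open>L\<^sup>1\<close> norm of \<open>v - v\<^sub>h\<close>, hence
  at most \<open>h M T\<close>. On the other hand \<open>v\<^sub>h = (G s - G (s + h)) / h\<close>, where \<open>G\<close> is the integral of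
  \<open>v\<close> from \<open>s\<close> to infinity. The inversion formula for the Abel transform says that \<open>pi G\<close> is the
  half-order integral of \<open>F\<close>, an operator with an integrable kernel, so the \<open>L\<^sup>2\<close> norm of \<open>G\<close> is
  controlled by that of \<open>F\<close>, which in turn is at most \<open>sqrt 2\<close> times that of \<open>f\<close> because
  \<open>dt = 2 x dx\<close> and \<open>x \<le> 1\<close>. Together
  \<open>\<parallel>v\<parallel>\<^sup>2 \<le> 2 h M T + 2 \<Phi> / h\<^sup>2\<close>, with \<open>\<Phi>\<close> any bound for the squared norm of \<open>F\<close>, and the choice
  \<open>h = (\<Phi> / (M T))\<^bsup>1/3\<^esup>\<close> gives the exponents
  \<open>1/3\<close> after a square root.

  The total variation is only available by duality, through smooth compactly supported fields. The
  bound on the pairing of \<open>v\<close> with its translates is therefore first proved with \<open>C\<^sup>1\<close> functions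
  \<open>\<psi>\<close> in place of the first factor, by moving the translation onto \<open>\<psi>\<close>, and then for \<open>v\<close> itself by
  approximation (\<open>variation_shift_C1\<close>, \<open>variation_shift_self\<close>). The remaining pillars are
  \<open>area_abel_inversion\<close>, \<open>squared_L2_interpolation\<close>, \<open>radial_variation_le_TV\<close> and the two changes of
  variables \<open>integral_area_map\<close> and \<open>nn_integral_cylinder\<close>.\<close>

section \<open>The Abel transform in the area variable\<close>

lemma nn_integral_inverse_sqrt:
  fixes a b :: real
  assumes "a \<le> b"
  shows "(\<integral>\<^sup>+s. ennreal (1 / sqrt (s - a)) * indicator {a<..<b} s \<partial>lborel) = ennreal (2 * sqrt (b - a))"
proof -
  have "((\<lambda>s. 1 / sqrt (s - a)) has_integral (2 * sqrt (b - a) - 2 * sqrt (a - a))) {a..b}"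
  proof (rule fundamental_theorem_of_calculus_interior[OF assms])
    show "continuous_on {a..b} (\<lambda>s. 2 * sqrt (s - a))"
      by (intro continuous_intros)
    show "((\<lambda>s. 2 * sqrt (s - a)) has_vector_derivative 1 / sqrt (s - a)) (at s)"
      if "s \<in> {a<..<b}" for s
      unfolding has_real_derivative_iff_has_vector_derivative[symmetric]
      using that by (auto intro!: derivative_eq_intros simp: field_simps)
  qed
  then have "((\<lambda>s. 1 / sqrt (s - a)) has_integral 2 * sqrt (b - a)) {a<..<b}"
    by (simp add: has_integral_Icc_iff_Ioo)
  from nn_integral_has_integral_lebesgue'[OF _ this] show ?thesis by simp
qed

text \<open>This beta integral is what makes the half-order integral, applied twice, an ordinary
  integral; its value does not depend on the interval.\<close>

lemma nn_integral_arcsine_density: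
  fixes a b :: real
  assumes "a < b"
  shows "(\<integral>\<^sup>+t. ennreal (1 / sqrt ((b - t) * (t - a))) * indicator {a<..<b} t \<partial>lborel) = ennreal pi"
proof -
  \<comment> \<open>The affine map of \<open>{a..b}\<close> onto \<open>{-1..1}\<close>; the antiderivative is \<open>arcsin\<close> of it.\<close>
  define g where "g t = (2 * t - a - b) / (b - a)" for t
  have "((\<lambda>t. 1 / sqrt ((b - t) * (t - a))) has_integral (arcsin (g b) - arcsin (g a))) {a..b}"
  proof (rule fundamental_theorem_of_calculus_interior)
    show "continuous_on {a..b} (\<lambda>t. arcsin (g t))"
      unfolding g_def using assms by (intro continuous_intros) (auto simp: field_simps)
    show "((\<lambda>t. arcsin (g t)) has_vector_derivative 1 / sqrt ((b - t) * (t - a))) (at t)"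
      if t: "t \<in> {a<..<b}" for t
    proof -
      have g: "-1 < g t" "g t < 1" using t by (auto simp: g_def field_simps)
      have "1 - (g t)\<^sup>2 = (2 / (b - a))\<^sup>2 * ((b - t) * (t - a))"
        using assms by (simp add: g_def divide_simps power2_eq_square) algebra
      then have "sqrt (1 - (g t)\<^sup>2) = 2 / (b - a) * sqrt ((b - t) * (t - a))"
        using assms by (simp add: real_sqrt_mult)
      moreover have "((\<lambda>t. arcsin (g t)) has_real_derivative inverse (sqrt (1 - (g t)\<^sup>2)) * (2 / (b - a))) (at t)"
        by (rule DERIV_chain2[where f=arcsin and g=g, OF DERIV_arcsin[OF g]])
          (unfold g_def[abs_def], use assms in \<open>auto intro!: derivative_eq_intros simp: power2_eq_square[symmetric] divide_simps\<close>, simp add: power2_eq_square algebra_simps)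
      ultimately show ?thesis
        unfolding has_real_derivative_iff_has_vector_derivative[symmetric]
        using assms by (simp add: field_simps)
    qed
  qed (use assms in auto)
  moreover have "g b = 1" "g a = -1" using assms by (auto simp: g_def field_simps)
  ultimately have "((\<lambda>t. 1 / sqrt ((b - t) * (t - a))) has_integral pi) {a<..<b}"
    by (simp add: has_integral_Icc_iff_Ioo)
  from nn_integral_has_integral_lebesgue'[OF _ this] show ?thesis by simp
qed

text \<open>The Abel transform at \<open>x\<close>, in terms of \<open>s = r\<^sup>2\<close> and \<open>t = x\<^sup>2\<close>.\<close>

definition area_abel :: "(real \<Rightarrow> real) \<Rightarrow> real \<Rightarrow> real" where
  "area_abel v t = (\<integral>s. indicator {t<..} s * (v s / sqrt (s - t)) \<partial>lborel)"

definition tail_integral :: "(real \<Rightarrow> real) \<Rightarrow> real \<Rightarrow> real" where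
  "tail_integral v s = (\<integral>\<sigma>. indicator {s<..} \<sigma> * v \<sigma> \<partial>lborel)"

text \<open>Inserting the definition of the transform gives a double integral over \<open>s < t < \<sigma>\<close>. In the
  other order of integration the inner integral is the arcsine integral, which is \<open>pi\<close>.\<close>

lemma area_abel_inversion:
  fixes v :: "real \<Rightarrow> real"
  assumes [measurable]: "v \<in> borel_measurable borel"
    and bd: "\<And>s. \<bar>v s\<bar> \<le> M" and supp: "\<And>s. s \<notin> {0<..<1} \<Longrightarrow> v s = 0"
    and s: "0 \<le> s"
  shows "(\<integral>t. indicator {s<..<1} t * (area_abel v t / sqrt (t - s)) \<partial>lborel) = pi * tail_integral v s"
    (is "?lhs = _")
proof -
  define k where "k = (\<lambda>(t, \<sigma>). v \<sigma> * (indicator {s<..<\<sigma>} t / sqrt ((\<sigma> - t) * (t - s))))"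
  have k_eq: "k (t, \<sigma>) = indicator {s<..<1} t * (indicator {t<..} \<sigma> * (v \<sigma> / sqrt (\<sigma> - t)) / sqrt (t - s))" for t \<sigma>
    using supp[of \<sigma>] by (auto simp: k_def real_sqrt_mult indicator_def)
  have [measurable]: "k \<in> borel_measurable (lborel \<Otimes>\<^sub>M lborel)"
    unfolding k_eq[abs_def] 
    by (subst measurable_cong[where g="\<lambda>(t, \<sigma>). if s < t \<and> t < \<sigma> then v \<sigma> / sqrt ((\<sigma> - t) * (t - s)) else 0"])
       (auto simp: k_def)
  have M: "0 \<le> M" using bd[of 0] by linarith
  have inner: "(\<integral>\<^sup>+t. ennreal (norm (k (t, \<sigma>))) \<partial>lborel) = ennreal \<bar>v \<sigma>\<bar> * (indicator {s<..} \<sigma> * ennreal pi)" for \<sigma>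
  proof (cases "s < \<sigma>")
    case True
    have "(\<integral>\<^sup>+t. ennreal (norm (k (t, \<sigma>))) \<partial>lborel)
      = (\<integral>\<^sup>+t. ennreal \<bar>v \<sigma>\<bar> * (ennreal (1 / sqrt ((\<sigma> - t) * (t - s))) * indicator {s<..<\<sigma>} t) \<partial>lborel)"
      by (intro nn_integral_cong) (auto simp: k_def indicator_def abs_mult ennreal_mult[symmetric])
    also have "\<dots> = ennreal \<bar>v \<sigma>\<bar> * ennreal pi"
      by (subst nn_integral_cmult) (auto simp: nn_integral_arcsine_density[OF True])
    finally show ?thesis using True by simp
  next
    case False
    then have "k (t, \<sigma>) = 0" for t by (auto simp: k_def)
    then show ?thesis using False by simp
  qed
  have inner': "(\<integral>t. k (t, \<sigma>) \<partial>lborel) = pi * (indicator {s<..} \<sigma> * v \<sigma>)" for \<sigma>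
  proof (cases "s < \<sigma>")
    case True
    have "(\<integral>t. indicator {s<..<\<sigma>} t / sqrt ((\<sigma> - t) * (t - s)) \<partial>lborel) = pi"
    proof (rule integral_eq_nn_integral[THEN trans])
      have "(\<integral>\<^sup>+t. ennreal (indicator {s<..<\<sigma>} t / sqrt ((\<sigma> - t) * (t - s))) \<partial>lborel) = ennreal pi"
        unfolding nn_integral_arcsine_density[OF True, symmetric]
        by (intro nn_integral_cong) (auto simp: indicator_def)
      then show "enn2real (\<integral>\<^sup>+t. ennreal (indicator {s<..<\<sigma>} t / sqrt ((\<sigma> - t) * (t - s))) \<partial>lborel) = pi" by simp
    qed (auto simp: indicator_def)
    moreover have "k (t, \<sigma>) = v \<sigma> * (indicator {s<..<\<sigma>} t / sqrt ((\<sigma> - t) * (t - s)))" for t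
      by (simp add: k_def)
    ultimately show ?thesis using True by (simp del: times_divide_eq_right)
  next
    case False
    then have "k (t, \<sigma>) = 0" for t by (auto simp: k_def)
    then show ?thesis using False by simp
  qed
  have int: "integrable (lborel \<Otimes>\<^sub>M lborel) k"
  proof (rule integrableI_bounded)
    have "(\<integral>\<^sup>+p. ennreal (norm (k p)) \<partial>(lborel \<Otimes>\<^sub>M lborel)) = (\<integral>\<^sup>+\<sigma>. \<integral>\<^sup>+t. ennreal (norm (k (t, \<sigma>))) \<partial>lborel \<partial>lborel)"
      by (rule lborel_pair.nn_integral_snd[symmetric]) simp
    also have "\<dots> \<le> (\<integral>\<^sup>+\<sigma>. ennreal (M * pi) * indicator {0..1::real} \<sigma> \<partial>lborel)"
      unfolding inner using bd supp M
      by (intro nn_integral_mono)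
        (auto simp: indicator_def ennreal_mult[symmetric] intro!: ennreal_leI mult_right_mono)
    also have "\<dots> < \<infinity>" by (simp add: nn_integral_cmult)
    finally show "(\<integral>\<^sup>+p. ennreal (norm (k p)) \<partial>(lborel \<Otimes>\<^sub>M lborel)) < \<infinity>" .
  qed simp
  have "?lhs = (\<integral>t. \<integral>\<sigma>. k (t, \<sigma>) \<partial>lborel \<partial>lborel)"
    unfolding k_eq area_abel_def integral_mult_right_zero integral_divide_zero ..
  also have "\<dots> = (\<integral>\<sigma>. \<integral>t. k (t, \<sigma>) \<partial>lborel \<partial>lborel)"
    using lborel_pair.Fubini_integral[of "\<lambda>t \<sigma>. k (t, \<sigma>)"] int by simp
  also have "\<dots> = pi * tail_integral v s"
    unfolding inner' tail_integral_def by simp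
  finally show ?thesis .
qed

lemma borel_measurable_area_abel_param [measurable (raw)]:
  assumes v: "(\<lambda>(x, s). v x s) \<in> borel_measurable (N \<Otimes>\<^sub>M borel)" and [measurable]: "t \<in> borel_measurable N"
  shows "(\<lambda>x. area_abel (v x) (t x)) \<in> borel_measurable N"
proof -
  note v[unfolded split_beta', measurable]
  have "(\<lambda>x. \<integral>s. (if t x < s then v x s / sqrt (s - t x) else 0) \<partial>lborel) \<in> borel_measurable N"
    by measurable
  also have "(\<lambda>x. \<integral>s. (if t x < s then v x s / sqrt (s - t x) else 0) \<partial>lborel) = (\<lambda>x. area_abel (v x) (t x))"
    unfolding area_abel_def by (intro ext Bochner_Integration.integral_cong) (auto simp: indicator_def)
  finally show ?thesis .
qed

lemma borel_measurable_tail_integral_param [measurable (raw)]: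
  assumes v: "(\<lambda>(x, s). v x s) \<in> borel_measurable (N \<Otimes>\<^sub>M borel)" and [measurable]: "t \<in> borel_measurable N"
  shows "(\<lambda>x. tail_integral (v x) (t x)) \<in> borel_measurable N"
proof -
  note v[unfolded split_beta', measurable]
  have "(\<lambda>x. \<integral>s. (if t x < s then v x s else 0) \<partial>lborel) \<in> borel_measurable N"
    by measurable
  also have "(\<lambda>x. \<integral>s. (if t x < s then v x s else 0) \<partial>lborel) = (\<lambda>x. tail_integral (v x) (t x))"
    unfolding tail_integral_def by (intro ext Bochner_Integration.integral_cong) (auto simp: indicator_def)
  finally show ?thesis .
qed

text \<open>The kernel \<open>1 / sqrt (t - s)\<close> of the inversion formula has integral at most \<open>2\<close> over the unit
  interval in either variable. The Cauchy-Schwarz inequality with this kernel as a weight (Schur's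
  test) therefore bounds the operator norm by \<open>2\<close>.\<close>

lemma tail_integral_L2_le_area_abel_L2:
  fixes v :: "real \<Rightarrow> real"
  assumes [measurable]: "v \<in> borel_measurable borel"
    and bd: "\<And>s. \<bar>v s\<bar> \<le> M" and supp: "\<And>s. s \<notin> {0<..<1} \<Longrightarrow> v s = 0"
  shows "ennreal (pi\<^sup>2) * (\<integral>\<^sup>+s. ennreal ((tail_integral v s)\<^sup>2) * indicator {0<..<1} s \<partial>lborel)
    \<le> 4 * (\<integral>\<^sup>+t. ennreal ((area_abel v t)\<^sup>2) * indicator {0<..<1} t \<partial>lborel)"
proof -
  let ?F = "area_abel v"
  define k where "k s t = (if s < t \<and> t < 1 then 1 / sqrt (t - s) else 0)" for s t :: real
  have [measurable]: "(\<lambda>(s, t). k s t) \<in> borel_measurable (borel \<Otimes>\<^sub>M borel)"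
    unfolding k_def by measurable
  have k0: "0 \<le> k s t" for s t by (simp add: k_def)
  have kint: "(\<integral>\<^sup>+t. ennreal (k s t) \<partial>lborel) \<le> 2" if "0 \<le> s" for s
  proof (cases "s \<le> 1")
    case True
    have "(\<integral>\<^sup>+t. ennreal (k s t) \<partial>lborel) = ennreal (2 * sqrt (1 - s))"
      unfolding nn_integral_inverse_sqrt[OF True, symmetric]
      by (intro nn_integral_cong) (auto simp: k_def indicator_def)
    also have "\<dots> \<le> ennreal 2" using that True by (intro ennreal_leI) simp
    finally show ?thesis by simp
  next
    case False
    then have "k s t = 0" for t by (auto simp: k_def)
    then show ?thesis by simp
  qed
  have kint': "(\<integral>\<^sup>+s. ennreal (k s t) * indicator {0<..<1} s \<partial>lborel) \<le> 2 * indicator {0<..<1} t" for t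
  proof (cases "0 < t \<and> t < 1")
    case True
    have *: "((\<lambda>s. 1 / sqrt (t - s)) has_integral (- 2 * sqrt (t - t) - (- 2 * sqrt (t - 0)))) {0..t}"
    proof (rule fundamental_theorem_of_calculus_interior)
      show "continuous_on {0..t} (\<lambda>s. - 2 * sqrt (t - s))" by (intro continuous_intros)
      show "((\<lambda>s. - 2 * sqrt (t - s)) has_vector_derivative 1 / sqrt (t - s)) (at s)"
        if "s \<in> {0<..<t}" for s
        unfolding has_real_derivative_iff_has_vector_derivative[symmetric]
        using that by (auto intro!: derivative_eq_intros simp: field_simps)
    qed (use True in auto)
    then have "((\<lambda>s. 1 / sqrt (t - s)) has_integral 2 * sqrt t) {0<..<t}"
      by (simp add: has_integral_Icc_iff_Ioo)
    from nn_integral_has_integral_lebesgue'[OF _ this]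
    have "(\<integral>\<^sup>+s. ennreal (1 / sqrt (t - s)) * indicator {0<..<t} s \<partial>lborel) = ennreal (2 * sqrt t)" by simp
    also have "(\<integral>\<^sup>+s. ennreal (1 / sqrt (t - s)) * indicator {0<..<t} s \<partial>lborel) = (\<integral>\<^sup>+s. ennreal (k s t) * indicator {0<..<1} s \<partial>lborel)"
      using True by (intro nn_integral_cong) (auto simp: k_def indicator_def)
    also have "ennreal (2 * sqrt t) \<le> ennreal 2" using True by (intro ennreal_leI) simp
    finally show ?thesis using True by simp
  next
    case False
    then have *: "ennreal (k s t) * indicator {0<..<1} s = 0" for s
      by (auto simp: k_def indicator_def)
    show ?thesis unfolding * by simp
  qed
  \<comment> \<open>The factor \<open>k s t\<close> is split evenly between the two factors of the Cauchy-Schwarz inequality.\<close>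
  have pw: "ennreal (pi\<^sup>2 * (tail_integral v s)\<^sup>2) \<le> 2 * (\<integral>\<^sup>+t. ennreal ((?F t)\<^sup>2 * k s t) \<partial>lborel)"
    if s: "0 < s" for s
  proof -
    have "ennreal \<bar>pi * tail_integral v s\<bar> \<le> (\<integral>\<^sup>+t. ennreal (norm (?F t * k s t)) \<partial>lborel)"
    proof -
      have "(\<integral>t. ?F t * k s t \<partial>lborel) = (\<integral>t. indicator {s<..<1} t * (?F t / sqrt (t - s)) \<partial>lborel)"
        by (intro Bochner_Integration.integral_cong) (auto simp: k_def indicator_def)
      also have "\<dots> = pi * tail_integral v s"
        by (rule area_abel_inversion[OF assms less_imp_le[OF s]])
      finally have *: "pi * tail_integral v s = (\<integral>t. ?F t * k s t \<partial>lborel)" ..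
      show ?thesis
      proof (cases "integrable lborel (\<lambda>t. ?F t * k s t)")
        case True
        then show ?thesis
          unfolding * using integral_norm_bound_ennreal[OF True] by simp
      next
        case False
        then show ?thesis unfolding * by (simp add: not_integrable_integral_eq)
      qed
    qed
    also have "(\<integral>\<^sup>+t. ennreal (norm (?F t * k s t)) \<partial>lborel)
      = (\<integral>\<^sup>+t. ennreal (sqrt (k s t)) * ennreal (\<bar>?F t\<bar> * sqrt (k s t)) \<partial>lborel)"
      using k0 by (intro nn_integral_cong) (simp add: abs_mult ennreal_mult[symmetric] mult.left_commute)
    finally have "(ennreal \<bar>pi * tail_integral v s\<bar>)\<^sup>2 
      \<le> (\<integral>\<^sup>+t. ennreal (sqrt (k s t)) * ennreal (\<bar>?F t\<bar> * sqrt (k s t)) \<partial>lborel)\<^sup>2"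
      by (rule power_mono) simp
    also have "\<dots> \<le> (\<integral>\<^sup>+t. (ennreal (sqrt (k s t)))\<^sup>2 \<partial>lborel) * (\<integral>\<^sup>+t. (ennreal (\<bar>?F t\<bar> * sqrt (k s t)))\<^sup>2 \<partial>lborel)"
      by (rule Cauchy_Schwarz_nn_integral) measurable
    also have "\<dots> = (\<integral>\<^sup>+t. ennreal (k s t) \<partial>lborel) * (\<integral>\<^sup>+t. ennreal ((?F t)\<^sup>2 * k s t) \<partial>lborel)"
      using k0 by (simp add: ennreal_power power_mult_distrib)
    also have "\<dots> \<le> 2 * (\<integral>\<^sup>+t. ennreal ((?F t)\<^sup>2 * k s t) \<partial>lborel)"
      using kint s by (intro mult_right_mono) auto
    finally show ?thesis by (simp add: ennreal_power power_mult_distrib)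
  qed
  have "ennreal (pi\<^sup>2) * (\<integral>\<^sup>+s. ennreal ((tail_integral v s)\<^sup>2) * indicator {0<..<1} s \<partial>lborel)
     = (\<integral>\<^sup>+s. ennreal (pi\<^sup>2 * (tail_integral v s)\<^sup>2) * indicator {0<..<1} s \<partial>lborel)"
    by (subst nn_integral_cmult[symmetric]) (auto simp: ennreal_mult mult.assoc)
  also have "\<dots> \<le> (\<integral>\<^sup>+s. 2 * ((\<integral>\<^sup>+t. ennreal ((?F t)\<^sup>2 * k s t) \<partial>lborel) * indicator {0<..<1} s) \<partial>lborel)"
    using pw by (intro nn_integral_mono) (auto simp: indicator_def)
  also have "\<dots> = 2 * (\<integral>\<^sup>+s. \<integral>\<^sup>+t. ennreal ((?F t)\<^sup>2 * k s t) * indicator {0<..<1} s \<partial>lborel \<partial>lborel)"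
    by (subst nn_integral_cmult) (auto simp: nn_integral_multc)
  also have "\<dots> = 2 * (\<integral>\<^sup>+t. \<integral>\<^sup>+s. ennreal ((?F t)\<^sup>2 * k s t) * indicator {0<..<1} s \<partial>lborel \<partial>lborel)"
    by (subst lborel_pair.Fubini') simp_all
  also have "\<dots> = 2 * (\<integral>\<^sup>+t. ennreal ((?F t)\<^sup>2) * (\<integral>\<^sup>+s. ennreal (k s t) * indicator {0<..<1} s \<partial>lborel) \<partial>lborel)"
    using k0 by (subst nn_integral_cmult[symmetric]) (auto simp: ennreal_mult mult.assoc)
  also have "\<dots> \<le> 2 * (\<integral>\<^sup>+t. ennreal ((?F t)\<^sup>2) * (2 * indicator {0<..<1} t) \<partial>lborel)"
    by (intro mult_left_mono nn_integral_mono kint') auto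
  also have "\<dots> = 4 * (\<integral>\<^sup>+t. ennreal ((area_abel v t)\<^sup>2) * indicator {0<..<1} t \<partial>lborel)"
    by (subst mult.left_commute, subst nn_integral_cmult) (auto simp: mult.assoc[symmetric])
  finally show ?thesis .
qed

section \<open>Continuously differentiable functions on the plane\<close>

definition C1_partials :: "(real \<times> real \<Rightarrow> real) \<Rightarrow> (real \<times> real \<Rightarrow> real) \<Rightarrow> (real \<times> real \<Rightarrow> real) \<Rightarrow> bool" where
  "C1_partials \<psi> \<psi>s \<psi>z \<longleftrightarrow> continuous_on UNIV \<psi>s \<and> continuous_on UNIV \<psi>z \<and>
     (\<forall>p. (\<psi> has_derivative (\<lambda>h. fst h * \<psi>s p + snd h * \<psi>z p)) (at p))"

lemma C1_partials_has_derivative: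
  "C1_partials \<psi> \<psi>s \<psi>z \<Longrightarrow> (\<psi> has_derivative (\<lambda>h. fst h * \<psi>s p + snd h * \<psi>z p)) (at p within S)"
  unfolding C1_partials_def by (rule has_derivative_at_withinI) (cases p, simp)

lemma C1_partials_continuous: "C1_partials \<psi> \<psi>s \<psi>z \<Longrightarrow> continuous_on S \<psi>"
  by (rule has_derivative_continuous_on[OF C1_partials_has_derivative])

lemma C1_partials_continuous_partials:
  assumes "C1_partials \<psi> \<psi>s \<psi>z"
  shows "continuous_on S \<psi>s" "continuous_on S \<psi>z"
  using assms unfolding C1_partials_def by (auto intro: continuous_on_subset)

lemma C1_partials_add:
  assumes f: "C1_partials f fs fz" and g: "C1_partials g gs gz"
  shows "C1_partials (\<lambda>p. f p + g p) (\<lambda>p. fs p + gs p) (\<lambda>p. fz p + gz p)"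
  unfolding C1_partials_def
proof (intro conjI allI)
  show "((\<lambda>p. f p + g p) has_derivative (\<lambda>h. fst h * (fs p + gs p) + snd h * (fz p + gz p))) (at p)" for p
    by (rule has_derivative_eq_rhs[OF has_derivative_add[OF C1_partials_has_derivative[OF f] C1_partials_has_derivative[OF g]]])
       (simp add: fun_eq_iff algebra_simps)
qed (intro continuous_on_add C1_partials_continuous_partials[OF f] C1_partials_continuous_partials[OF g])+

lemma C1_partials_mult:
  assumes f: "C1_partials f fs fz" and g: "C1_partials g gs gz"
  shows "C1_partials (\<lambda>p. f p * g p) (\<lambda>p. fs p * g p + f p * gs p) (\<lambda>p. fz p * g p + f p * gz p)"
  unfolding C1_partials_def
proof (intro conjI allI)
  show "((\<lambda>p. f p * g p) has_derivative
      (\<lambda>h. fst h * (fs p * g p + f p * gs p) + snd h * (fz p * g p + f p * gz p))) (at p)" for p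
    by (rule has_derivative_eq_rhs[OF has_derivative_mult[OF C1_partials_has_derivative[OF f] C1_partials_has_derivative[OF g]]])
       (simp add: fun_eq_iff algebra_simps)
qed (intro continuous_on_add continuous_on_mult C1_partials_continuous[OF f] C1_partials_continuous[OF g]
      C1_partials_continuous_partials[OF f] C1_partials_continuous_partials[OF g])+

lemma C1_partials_const: "C1_partials (\<lambda>_. c) (\<lambda>_. 0) (\<lambda>_. 0)"
  unfolding C1_partials_def by (auto intro!: derivative_eq_intros)

lemma C1_partials_of_fst:
  assumes d: "\<And>x. (q has_real_derivative q' x) (at x)" and c: "continuous_on UNIV q'"
  shows "C1_partials (\<lambda>p. q (fst p)) (\<lambda>p. q' (fst p)) (\<lambda>_. 0)"
  unfolding C1_partials_def
proof (intro conjI allI)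
  show "((\<lambda>p. q (fst p)) has_derivative (\<lambda>h. fst h * q' (fst p) + snd h * 0)) (at p)" for p :: "real \<times> real"
    by (rule has_derivative_eq_rhs[OF DERIV_compose_FDERIV[OF d has_derivative_fst[OF has_derivative_ident]]])
       (simp add: fun_eq_iff mult.commute)
  show "continuous_on UNIV (\<lambda>p :: real \<times> real. q' (fst p))"
    by (rule continuous_on_compose2[OF c]) (auto intro: continuous_intros)
qed simp

lemma C1_partials_of_snd:
  assumes d: "\<And>x. (q has_real_derivative q' x) (at x)" and c: "continuous_on UNIV q'"
  shows "C1_partials (\<lambda>p. q (snd p)) (\<lambda>_. 0) (\<lambda>p. q' (snd p))"
  unfolding C1_partials_def
proof (intro conjI allI)
  show "((\<lambda>p. q (snd p)) has_derivative (\<lambda>h. fst h * 0 + snd h * q' (snd p))) (at p)" for p :: "real \<times> real"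
    by (rule has_derivative_eq_rhs[OF DERIV_compose_FDERIV[OF d has_derivative_snd[OF has_derivative_ident]]])
       (simp add: fun_eq_iff mult.commute)
  show "continuous_on UNIV (\<lambda>p :: real \<times> real. q' (snd p))"
    by (rule continuous_on_compose2[OF c]) (auto intro: continuous_intros)
qed simp

lemma C1_partials_reparam_fst:
  assumes \<psi>: "C1_partials \<psi> \<psi>s \<psi>z"
    and q: "\<And>x. (q has_real_derivative q' x) (at x)" "continuous_on UNIV q'"
  shows "C1_partials (\<lambda>p. \<psi> (q (fst p), snd p)) (\<lambda>p. q' (fst p) * \<psi>s (q (fst p), snd p))
           (\<lambda>p. \<psi>z (q (fst p), snd p))"
  unfolding C1_partials_def
proof (intro conjI allI)
  have cq: "continuous_on UNIV (\<lambda>p::real\<times>real. (q (fst p), snd p))"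
    by (intro continuous_on_Pair C1_partials_continuous[OF C1_partials_of_fst[OF q]] continuous_intros)
  have cq': "continuous_on UNIV (\<lambda>p::real\<times>real. q' (fst p))"
    by (rule C1_partials_continuous_partials[OF C1_partials_of_fst[OF q]])
  show "continuous_on UNIV (\<lambda>p. q' (fst p) * \<psi>s (q (fst p), snd p))"
    by (intro continuous_on_mult cq' continuous_on_compose2[OF C1_partials_continuous_partials(1)[OF \<psi>] cq]) auto
  show "continuous_on UNIV (\<lambda>p. \<psi>z (q (fst p), snd p))"
    by (intro continuous_on_compose2[OF C1_partials_continuous_partials(2)[OF \<psi>] cq]) auto
  fix p :: "real \<times> real"
  have 1: "((\<lambda>p::real\<times>real. (q (fst p), snd p)) has_derivative (\<lambda>h. (fst h * q' (fst p), snd h))) (at p)"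
    by (intro has_derivative_Pair DERIV_compose_FDERIV[OF q(1)] has_derivative_fst has_derivative_snd has_derivative_ident)
  show "((\<lambda>p. \<psi> (q (fst p), snd p)) has_derivative
      (\<lambda>h. fst h * (q' (fst p) * \<psi>s (q (fst p), snd p)) + snd h * \<psi>z (q (fst p), snd p))) (at p)"
    by (rule has_derivative_eq_rhs[OF has_derivative_compose[OF 1 C1_partials_has_derivative[OF \<psi>]]])
       (simp add: fun_eq_iff mult.assoc)
qed

text \<open>A step from 0 to 1 over the unit interval that is only as smooth as needed: it is composed
  from squares of positive parts, which are continuously differentiable.\<close>

definition smooth_step :: "real \<Rightarrow> real" where
  "smooth_step x = 1 - (max 0 (1 - (max 0 x)\<^sup>2))\<^sup>2"

definition smooth_step' :: "real \<Rightarrow> real" where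
  "smooth_step' x = 4 * max 0 (1 - (max 0 x)\<^sup>2) * max 0 x"

lemma has_real_derivative_positive_part_squared:
  "((\<lambda>x. (max 0 x)\<^sup>2) has_real_derivative 2 * max 0 x) (at (x::real))"
proof (cases "x = 0")
  case True
  have "((\<lambda>h. ((max 0 (0 + h))\<^sup>2 - (max 0 0)\<^sup>2) / h) \<longlongrightarrow> 0) (at (0::real))"
  proof (rule Lim_null_comparison[where g = "\<lambda>h::real. \<bar>h\<bar>"])
    show "\<forall>\<^sub>F h in at 0. norm (((max 0 (0 + h))\<^sup>2 - (max 0 0)\<^sup>2) / h) \<le> \<bar>h::real\<bar>"
      by (intro always_eventually) (auto simp: max_def power2_eq_square)
    show "((\<lambda>h::real. \<bar>h\<bar>) \<longlongrightarrow> 0) (at 0)"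
      by (rule tendsto_eq_intros | simp)+
  qed
  then show ?thesis using True by (simp add: DERIV_def)
next
  case False
  show ?thesis
  proof (cases "x > 0")
    case True
    have "((\<lambda>x. x\<^sup>2) has_real_derivative 2 * max 0 x) (at x)"
      using True by (auto intro!: derivative_eq_intros)
    then show ?thesis
      by (rule DERIV_cong_ev[THEN iffD1, OF refl _ refl, rotated])
        (use True in \<open>auto simp: max_def intro!: eventually_mono[OF eventually_nhds_in_open[of "{0<..}"]]\<close>)
  next
    case F: False
    have "((\<lambda>x. 0) has_real_derivative 2 * max 0 x) (at x)"
      using F by (auto intro!: derivative_eq_intros simp: max_def)
    then show ?thesis
      by (rule DERIV_cong_ev[THEN iffD1, OF refl _ refl, rotated])
        (use F False in \<open>auto simp: max_def intro!: eventually_mono[OF eventually_nhds_in_open[of "{..<0}"]]\<close>)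
  qed
qed

lemma smooth_step_deriv: "(smooth_step has_real_derivative smooth_step' x) (at x)"
proof -
  have 1: "((\<lambda>x. 1 - (max 0 x)\<^sup>2) has_real_derivative - (2 * max 0 x)) (at x)"
    using DERIV_diff[OF DERIV_const[of 1] has_real_derivative_positive_part_squared] by simp
  have "((\<lambda>x. (max 0 (1 - (max 0 x)\<^sup>2))\<^sup>2) has_real_derivative 
      (2 * max 0 (1 - (max 0 x)\<^sup>2)) * (- (2 * max 0 x))) (at x)"
    by (rule DERIV_chain2[OF has_real_derivative_positive_part_squared 1])
  from DERIV_diff[OF DERIV_const[of 1] this] show ?thesis
    unfolding smooth_step_def[abs_def] smooth_step'_def by (simp add: mult.assoc)
qed

lemma smooth_step'_continuous: "continuous_on S smooth_step'"
  unfolding smooth_step'_def[abs_def] by (intro continuous_intros)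

lemma smooth_step_le_0: "x \<le> 0 \<Longrightarrow> smooth_step x = 0"
  and smooth_step_ge_1: "x \<ge> 1 \<Longrightarrow> smooth_step x = 1"
  and smooth_step'_ge_1: "x \<ge> 1 \<Longrightarrow> smooth_step' x = 0"
proof -
  have "1 \<le> (max 0 x)\<^sup>2" if "1 \<le> x" using that by (intro one_le_power) simp
  then show "x \<ge> 1 \<Longrightarrow> smooth_step x = 1" "x \<ge> 1 \<Longrightarrow> smooth_step' x = 0"
    by (simp_all add: smooth_step_def smooth_step'_def)
qed (simp add: smooth_step_def)

lemma smooth_step_bounds: "0 \<le> smooth_step x" "smooth_step x \<le> 1"
proof -
  have "(max 0 (1 - (max 0 x)\<^sup>2))\<^sup>2 \<le> 1" by (intro power_le_one) auto
  then show "0 \<le> smooth_step x" "smooth_step x \<le> 1" by (auto simp: smooth_step_def)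
qed

lemma C1_partials_smooth_step_affine:
  fixes a b :: real
  shows "C1_partials (\<lambda>p. smooth_step (a * fst p + b)) (\<lambda>p. a * smooth_step' (a * fst p + b)) (\<lambda>_. 0)"
    and "C1_partials (\<lambda>p. smooth_step (a * snd p + b)) (\<lambda>_. 0) (\<lambda>p. a * smooth_step' (a * snd p + b))"
proof -
  have d: "((\<lambda>x. smooth_step (a * x + b)) has_real_derivative a * smooth_step' (a * x + b)) (at x)" for x
  proof -
    have "((\<lambda>x. a * x + b) has_real_derivative a) (at x)" by (auto intro!: derivative_eq_intros)
    from DERIV_chain2[OF smooth_step_deriv this] show ?thesis by (simp add: mult.commute)
  qed
  have c: "continuous_on UNIV (\<lambda>x. a * smooth_step' (a * x + b))"
    by (intro continuous_intros continuous_on_compose2[OF smooth_step'_continuous[of UNIV]]) auto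
  show "C1_partials (\<lambda>p. smooth_step (a * fst p + b)) (\<lambda>p. a * smooth_step' (a * fst p + b)) (\<lambda>_. 0)"
    "C1_partials (\<lambda>p. smooth_step (a * snd p + b)) (\<lambda>_. 0) (\<lambda>p. a * smooth_step' (a * snd p + b))"
    using C1_partials_of_fst[OF d c] C1_partials_of_snd[OF d c] by simp_all
qed

text \<open>The support condition for test functions in the area variable. It says nothing about large \<open>s\<close>:
  the profile vanishes near the lateral boundary, so a cut-off there changes no integral, and the
  condition stays true when the test function is translated towards larger \<open>s\<close>.\<close>

definition clear_of_axis_and_ends :: "real \<Rightarrow> (real \<times> real \<Rightarrow> real) \<Rightarrow> bool" where
  "clear_of_axis_and_ends \<epsilon> \<psi> \<longleftrightarrow> (\<forall>s z. s \<le> \<epsilon> \<or> 1 - \<epsilon> \<le> \<bar>z\<bar> \<longrightarrow> \<psi> (s, z) = 0)"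

text \<open>The continuously differentiable functions form an algebra that separates points, so the
  Stone-Weierstrass theorem applies to them directly.\<close>

lemma C1_uniform_approximation:
  assumes "compact S" "continuous_on S c" "0 < e"
  shows "\<exists>\<psi> \<psi>s \<psi>z. C1_partials \<psi> \<psi>s \<psi>z \<and> (\<forall>p\<in>S. \<bar>c p - \<psi> p\<bar> < e)"
proof -
  interpret function_ring_on "{\<psi>. \<exists>\<psi>s \<psi>z. C1_partials \<psi> \<psi>s \<psi>z}" S
  proof
    show "continuous_on S f" if "f \<in> {\<psi>. \<exists>\<psi>s \<psi>z. C1_partials \<psi> \<psi>s \<psi>z}" for f
      using that C1_partials_continuous[of f] by blast
    show "(\<lambda>x. f x + g x) \<in> {\<psi>. \<exists>\<psi>s \<psi>z. C1_partials \<psi> \<psi>s \<psi>z}"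
      if "f \<in> {\<psi>. \<exists>\<psi>s \<psi>z. C1_partials \<psi> \<psi>s \<psi>z}" "g \<in> {\<psi>. \<exists>\<psi>s \<psi>z. C1_partials \<psi> \<psi>s \<psi>z}" for f g
      using that C1_partials_add[of f _ _ g] by blast
    show "(\<lambda>x. f x * g x) \<in> {\<psi>. \<exists>\<psi>s \<psi>z. C1_partials \<psi> \<psi>s \<psi>z}"
      if "f \<in> {\<psi>. \<exists>\<psi>s \<psi>z. C1_partials \<psi> \<psi>s \<psi>z}" "g \<in> {\<psi>. \<exists>\<psi>s \<psi>z. C1_partials \<psi> \<psi>s \<psi>z}" for f g
      using that C1_partials_mult[of f _ _ g] by blast
    show "(\<lambda>_. c) \<in> {\<psi>. \<exists>\<psi>s \<psi>z. C1_partials \<psi> \<psi>s \<psi>z}" for c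
      using C1_partials_const[of c] by blast
    fix x y :: "real \<times> real" assume "x \<noteq> y"
    have "C1_partials fst (\<lambda>_. 1) (\<lambda>_. 0)" "C1_partials snd (\<lambda>_. 0) (\<lambda>_. 1)"
      unfolding C1_partials_def by (auto intro!: derivative_eq_intros)
    then have "fst \<in> {\<psi>. \<exists>\<psi>s \<psi>z. C1_partials \<psi> \<psi>s \<psi>z}" "snd \<in> {\<psi>. \<exists>\<psi>s \<psi>z. C1_partials \<psi> \<psi>s \<psi>z}"
      by blast+
    moreover have "fst x \<noteq> fst y \<or> snd x \<noteq> snd y" using \<open>x \<noteq> y\<close> prod_eqI by blast
    ultimately show "\<exists>f\<in>{\<psi>. \<exists>\<psi>s \<psi>z. C1_partials \<psi> \<psi>s \<psi>z}. f x \<noteq> f y" by blast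
  qed (rule assms(1))
  show ?thesis using Stone_Weierstrass_basic[OF assms(2,3)] by blast
qed

text \<open>A measurable function is an almost everywhere limit of continuous functions; these are truncated
  at \<open>M\<close> and \<open>-M\<close>, replaced by uniformly close \<open>C\<^sup>1\<close> functions and cut off near the axis and the two ends.
  Keeping the bound \<open>M\<close> up to an error that tends to 0 is essential, since the total variation is
  tested against the supremum norm of the field.\<close>

lemma C1_approximation_AE:
  fixes v :: "real \<times> real \<Rightarrow> real"
  assumes v: "v \<in> borel_measurable lborel" and bd: "\<And>p. \<bar>v p\<bar> \<le> M"
  obtains \<psi> \<psi>s \<psi>z \<epsilon> where
    "\<And>n::nat. C1_partials (\<psi> n) (\<psi>s n) (\<psi>z n)"
    "\<And>n p. p \<in> Omega \<Longrightarrow> \<bar>\<psi> n p\<bar> \<le> M + 1 / real (Suc n)"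
    "\<And>n. 0 < \<epsilon> n" "\<And>n. clear_of_axis_and_ends (\<epsilon> n) (\<psi> n)"
    "AE p in lborel. p \<in> {0<..1} \<times> {-1<..<1} \<longrightarrow> (\<lambda>n. \<psi> n p) \<longlonglongrightarrow> v p"
proof -
  have M: "0 \<le> M" using bd[of undefined] by linarith
  have "v \<in> borel_measurable (lebesgue_on UNIV)"
    using v by (simp add: lebesgue_on_UNIV_eq measurable_completion)
  then have "v measurable_on UNIV"
    by (subst measurable_on_iff_borel_measurable) auto
  then obtain N c where N: "negligible N" and c: "\<And>n. continuous_on UNIV (c n)"
    and lim: "\<And>p. p \<notin> N \<Longrightarrow> (\<lambda>n. c n p) \<longlonglongrightarrow> v p"
    unfolding measurable_on_def by auto
  define d where "d n p = max (- M) (min M (c n p))" for n :: nat and p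
  have dc: "continuous_on S (d n)" for n S
    unfolding d_def by (intro continuous_intros continuous_on_subset[OF c]) auto
  have dlim: "(\<lambda>n. d n p) \<longlonglongrightarrow> v p" if "p \<notin> N" for p
  proof -
    have "(\<lambda>n. d n p) \<longlonglongrightarrow> max (- M) (min M (v p))"
      unfolding d_def by (intro tendsto_intros lim that)
    also have "max (- M) (min M (v p)) = v p" using bd[of p] by auto
    finally show ?thesis .
  qed
  have Om: "compact Omega" unfolding Omega_def by (intro compact_Times) auto
  define m where "m n = real (Suc (Suc n))" for n
  have m: "1 < m n" for n by (simp add: m_def)
  \<comment> \<open>A cut-off that vanishes within \<open>1 / m n\<close> of the axis and of the ends and tends to 1 elsewhere.\<close>
  define \<kappa> where "\<kappa> n p = smooth_step (m n * fst p + (-1)) * (smooth_step (m n * snd p + (m n - 1)) * smooth_step (- m n * snd p + (m n - 1)))" for n p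
  have \<kappa>01: "0 \<le> \<kappa> n p" "\<kappa> n p \<le> 1" for n p
    unfolding \<kappa>_def by (intro mult_nonneg_nonneg mult_le_one smooth_step_bounds)+
  define Q where "Q n t \<longleftrightarrow> C1_partials (fst t) (fst (snd t)) (snd (snd t))
      \<and> (\<forall>p\<in>Omega. \<bar>\<kappa> n p * d n p - fst t p\<bar> \<le> 1 / real (Suc n)) \<and> (\<forall>p. \<kappa> n p = 0 \<longrightarrow> fst t p = 0)" for n t
  have "\<exists>t. Q n t" for n
  proof -
    obtain P Ps Pz where P: "C1_partials P Ps Pz" and Pd: "\<And>p. p \<in> Omega \<Longrightarrow> \<bar>d n p - P p\<bar> < 1 / real (Suc n)"
      using C1_uniform_approximation[OF Om dc[of Omega n], of "1 / real (Suc n)"] by auto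
    note \<kappa> = C1_partials_mult[OF C1_partials_smooth_step_affine(1)[of "m n" "-1"] 
          C1_partials_mult[OF C1_partials_smooth_step_affine(2)[of "m n" "m n - 1"]
             C1_partials_smooth_step_affine(2)[of "- m n" "m n - 1"]], folded \<kappa>_def]
    obtain a b where C: "C1_partials (\<lambda>p. \<kappa> n p * P p) a b"
      using C1_partials_mult[OF \<kappa> P] by blast
    have "\<bar>\<kappa> n p * d n p - \<kappa> n p * P p\<bar> \<le> 1 / real (Suc n)" if "p \<in> Omega" for p
    proof -
      have "\<bar>\<kappa> n p * d n p - \<kappa> n p * P p\<bar> = \<kappa> n p * \<bar>d n p - P p\<bar>"
        using \<kappa>01(1)[of n p] by (simp add: right_diff_distrib[symmetric] abs_mult)
      also have "\<dots> \<le> 1 * \<bar>d n p - P p\<bar>" using \<kappa>01[of n p] by (intro mult_right_mono) auto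
      finally show ?thesis using Pd[OF that] by simp
    qed
    then show ?thesis
      unfolding Q_def using C by (intro exI[of _ "(\<lambda>p. \<kappa> n p * P p, a, b)"]) auto
  qed
  then obtain t where t: "\<And>n. Q n (t n)"
    using choice[of Q] by auto
  define \<psi> where "\<psi> n = fst (t n)" for n
  have \<psi>: "C1_partials (\<psi> n) (fst (snd (t n))) (snd (snd (t n)))"
    and \<psi>d: "\<And>p. p \<in> Omega \<Longrightarrow> \<bar>\<kappa> n p * d n p - \<psi> n p\<bar> \<le> 1 / real (Suc n)"
    and \<psi>0: "\<And>p. \<kappa> n p = 0 \<Longrightarrow> \<psi> n p = 0" for n
    using t[of n] by (auto simp: Q_def \<psi>_def)
  show thesis
  proof (rule that[of \<psi> _ _ "\<lambda>n. 1 / m n", OF \<psi>])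
    fix n p assume p: "p \<in> Omega"
    have "\<bar>\<kappa> n p * d n p\<bar> \<le> 1 * M"
      unfolding abs_mult using \<kappa>01[of n p] M by (intro mult_mono) (auto simp: d_def)
    then show "\<bar>\<psi> n p\<bar> \<le> M + 1 / real (Suc n)" using \<psi>d[OF p, of n] by linarith
  next
    show "clear_of_axis_and_ends (1 / m n) (\<psi> n)" for n
      unfolding clear_of_axis_and_ends_def
    proof (intro allI impI)
      fix s z assume "s \<le> 1 / m n \<or> 1 - 1 / m n \<le> \<bar>z\<bar>"
      then consider "m n * s + (-1) \<le> 0" | "m n * z + (m n - 1) \<le> 0" | "- m n * z + (m n - 1) \<le> 0"
        using m[of n] by (auto simp: field_simps abs_if split: if_splits)
      then show "\<psi> n (s, z) = 0"
        by cases (auto simp: \<kappa>_def smooth_step_le_0 intro!: \<psi>0)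
    qed
  next
    have "AE p in lebesgue. p \<notin> N"
      using N by (intro AE_not_in) (simp add: negligible_iff_null_sets)
    then have "AE p in lborel. p \<notin> N"
      by (simp only: AE_completion_iff)
    then show "AE p in lborel. p \<in> {0<..1} \<times> {-1<..<1} \<longrightarrow> (\<lambda>n. \<psi> n p) \<longlonglongrightarrow> v p"
    proof (eventually_elim, intro impI)
      fix p assume pN: "p \<notin> N" and p: "p \<in> {0<..1::real} \<times> {-1<..<1::real}"
      have ev: "\<forall>\<^sub>F n in sequentially. 1 \<le> m n * a + (- 1)" if "0 < a" for a
      proof -
        obtain k where k: "2 / a < real k" using reals_Archimedean2 by blast
        show ?thesis
        proof (rule eventually_sequentiallyI[of k])
          fix n assume "k \<le> n"
          then have "2 / a \<le> m n" using k by (simp add: m_def)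
          then show "1 \<le> m n * a + (-1)" using that by (simp add: field_simps)
        qed
      qed
      have a: "0 < fst p" "0 < 1 + snd p" "0 < 1 - snd p" using p by auto
      have "\<forall>\<^sub>F n in sequentially. \<kappa> n p = 1"
        using ev[OF a(1)] ev[OF a(2)] ev[OF a(3)]
      proof eventually_elim
        case (elim n)
        then show ?case by (simp add: \<kappa>_def smooth_step_ge_1 algebra_simps)
      qed
      then have 1: "(\<lambda>n. \<kappa> n p) \<longlonglongrightarrow> 1" by (rule tendsto_eventually)
      have "p \<in> Omega" using p by (auto simp: Omega_def)
      then have "(\<lambda>n. \<kappa> n p * d n p - \<psi> n p) \<longlonglongrightarrow> 0"
        by (intro Lim_null_comparison[OF _ LIMSEQ_inverse_real_of_nat])
          (auto simp: inverse_eq_divide simp del: of_nat_Suc intro!: always_eventually \<psi>d)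
      from tendsto_diff[OF tendsto_mult[OF 1 dlim[OF pN]] this]
      show "(\<lambda>n. \<psi> n p) \<longlonglongrightarrow> v p" by simp
    qed
  next
    show "0 < 1 / m n" for n using m[of n] by simp
  qed
qed

section \<open>Interpolation between the variation and the tail integral\<close>

lemma integrable_bounded_of_bounded_support:
  fixes w :: "'a::euclidean_space \<Rightarrow> real"
  assumes w: "w \<in> borel_measurable lborel" and B: "\<And>p. p \<in> K \<Longrightarrow> \<bar>w p\<bar> \<le> B"
    and K: "compact K" "\<And>p. p \<notin> K \<Longrightarrow> w p = 0"
  shows "integrable lborel w"
proof -
  have "integrable lborel (\<lambda>p. indicator K p *\<^sub>R w p)"
    using w B K emeasure_bounded_finite[of K]
    by (intro integrableI_bounded_set_indicator[where B=B]) (auto simp: compact_imp_bounded borel_compact)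
  moreover have "(\<lambda>p. indicator K p *\<^sub>R w p) = w"
    using K(2) by (auto simp: fun_eq_iff indicator_def)
  ultimately show ?thesis by simp
qed

lemma integrable_indicator_mult_const:
  fixes A :: "'a::euclidean_space set" and c :: real
  assumes "A \<in> sets borel" "bounded A"
  shows "integrable lborel (\<lambda>p. indicator A p * c)"
  using assms by (intro integrable_mult_left integrable_real_indicator emeasure_bounded_finite) auto

lemma integrable_continuous_mult_of_bounded_support:
  fixes w \<phi> :: "'a::euclidean_space \<Rightarrow> real"
  assumes \<phi>: "continuous_on UNIV \<phi>" and w: "w \<in> borel_measurable lborel" "\<And>p. \<bar>w p\<bar> \<le> B"
    and K: "compact K" "\<And>p. p \<notin> K \<Longrightarrow> w p = 0"
  shows "integrable lborel (\<lambda>p. \<phi> p * w p)"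
proof -
  have [measurable]: "\<phi> \<in> borel_measurable borel" using \<phi> by (rule borel_measurable_continuous_onI)
  obtain C where C: "\<And>p. p \<in> K \<Longrightarrow> \<bar>\<phi> p\<bar> \<le> C"
    using compact_imp_bounded[OF compact_continuous_image[OF continuous_on_subset[OF \<phi> subset_UNIV] K(1)]]
    by (auto simp: bounded_iff)
  show ?thesis
  proof (rule integrable_bounded_of_bounded_support[OF _ _ K(1)])
    fix p assume p: "p \<in> K"
    show "\<bar>\<phi> p * w p\<bar> \<le> C * B"
      unfolding abs_mult using C[OF p] w(2)[of p] by (intro mult_mono) auto
  qed (use w K(2) in auto)
qed

lemma lborel_integral_translate:
  fixes f :: "'a::euclidean_space \<Rightarrow> real"
  assumes "f \<in> borel_measurable borel"
  shows "(\<integral>p. f (p + c) \<partial>lborel) = (\<integral>p. f p \<partial>lborel)"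
proof -
  have "(\<integral>p. f p \<partial>lborel) = (\<integral>p. f p \<partial>distr lborel borel ((+) c))"
    by (simp add: lborel_distr_plus)
  also have "\<dots> = (\<integral>p. f (c + p) \<partial>lborel)"
    using assms by (intro integral_distr) auto
  finally show ?thesis by (simp add: add.commute)
qed

text \<open>The total variation enters the argument only through this inequality, which controls the
  radial part of the derivative tested against \<open>C\<^sup>1\<close> functions.\<close>

definition radial_variation_le :: "(real \<times> real \<Rightarrow> real) \<Rightarrow> real \<Rightarrow> bool" where
  "radial_variation_le v T \<longleftrightarrow> (\<forall>\<psi> \<psi>s \<psi>z \<epsilon> K. C1_partials \<psi> \<psi>s \<psi>z \<longrightarrow> 0 < \<epsilon> \<longrightarrow>
     clear_of_axis_and_ends \<epsilon> \<psi> \<longrightarrow> 0 < K \<longrightarrow> (\<forall>p\<in>Omega. \<bar>\<psi> p\<bar> \<le> K) \<longrightarrow> (\<integral>p. v p * \<psi>s p \<partial>lborel) \<le> K * T)"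

locale bounded_area_profile =
  fixes v :: "real \<times> real \<Rightarrow> real" and M T :: real
  assumes v_measurable [measurable]: "v \<in> borel_measurable borel"
    and v_bounded: "\<And>p. \<bar>v p\<bar> \<le> M"
    and v_support: "\<And>p. p \<notin> {0<..<1} \<times> {-1<..<1} \<Longrightarrow> v p = 0"
    and T_nonneg: "0 \<le> T"
    and v_variation: "radial_variation_le v T"
begin

lemma M_nonneg: "0 \<le> M" using v_bounded[of undefined] by linarith

lemma compact_Omega: "compact Omega" unfolding Omega_def by (intro compact_Times) auto

lemma v_outside_Omega: "p \<notin> Omega \<Longrightarrow> v p = 0"
  by (rule v_support) (auto simp: Omega_def)

text \<open>Translating the integral moves the shift from \<open>v\<close> to \<open>\<psi>\<close>, and the increment of \<open>\<psi>\<close> is the integral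
  over \<open>\<sigma>\<close> in \<open>{0..\<tau>}\<close> of \<open>\<psi>s\<close> translated by \<open>\<sigma>\<close>. Each translate of \<open>\<psi>\<close> is again an admissible test
  function with the same bound, so every \<open>\<sigma>\<close> contributes at most \<open>K * T\<close>.\<close>

lemma variation_shift_C1:
  assumes \<psi>: "C1_partials \<psi> \<psi>s \<psi>z" and \<epsilon>: "0 < \<epsilon>" "clear_of_axis_and_ends \<epsilon> \<psi>"
    and K0: "0 < K" and K: "\<And>p. p \<in> Omega \<Longrightarrow> \<bar>\<psi> p\<bar> \<le> K" and \<tau>: "0 \<le> \<tau>"
  shows "(\<integral>p. \<psi> p * (v p - v (p + (\<tau>, 0))) \<partial>lborel) \<le> \<tau> * (K * T)"
proof -
  note c\<psi> = C1_partials_continuous[OF \<psi>, of UNIV] and c\<psi>s = C1_partials_continuous_partials(1)[OF \<psi>, of UNIV]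
  have [measurable]: "\<psi> \<in> borel_measurable borel" "\<psi>s \<in> borel_measurable borel"
    using c\<psi> c\<psi>s by (auto intro: borel_measurable_continuous_onI)
  have i1: "integrable lborel (\<lambda>p. \<psi> p * v p)"
    by (rule integrable_continuous_mult_of_bounded_support[OF c\<psi> _ v_bounded compact_Omega v_outside_Omega]) simp
  have c\<psi>': "continuous_on UNIV (\<lambda>p. \<psi> (p - (\<tau>, 0)))"
    by (intro continuous_on_compose2[OF c\<psi>] continuous_intros) auto
  have i2: "integrable lborel (\<lambda>p. \<psi> (p - (\<tau>, 0)) * v p)"
    by (rule integrable_continuous_mult_of_bounded_support[OF c\<psi>' _ v_bounded compact_Omega v_outside_Omega]) simp
  have i2': "integrable lborel (\<lambda>p. \<psi> p * v (p + (\<tau>, 0)))"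
  proof (rule integrable_continuous_mult_of_bounded_support[OF c\<psi> _ v_bounded])
    show "compact ((\<lambda>p. (- \<tau>, 0) + p) ` Omega)" by (rule compact_translation[OF compact_Omega])
    show "v (p + (\<tau>, 0)) = 0" if p: "p \<notin> (\<lambda>p. (- \<tau>, 0) + p) ` Omega" for p
    proof (rule v_outside_Omega)
      show "p + (\<tau>, 0) \<notin> Omega"
        using p by (auto simp: image_iff prod_eq_iff dest: bspec[where x="p + (\<tau>, 0)"])
    qed
  qed simp
  define k where "k = (\<lambda>(p, \<sigma>). indicator {0..\<tau>} \<sigma> * (\<psi>s (p - (\<sigma>, 0)) * v p))"
  have ki: "integrable (lborel \<Otimes>\<^sub>M lborel) k"
  proof -
    have "integrable lborel (\<lambda>q. \<psi>s (fst q - (snd q, 0)) * (indicator {0..\<tau>} (snd q) * v (fst q)))"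
    proof (rule integrable_continuous_mult_of_bounded_support)
      show "continuous_on UNIV (\<lambda>q::(real \<times> real) \<times> real. \<psi>s (fst q - (snd q, 0)))"
        by (intro continuous_on_compose2[OF c\<psi>s] continuous_intros) auto
      show "compact (Omega \<times> {0..\<tau>})" by (intro compact_Times compact_Omega) auto
      show "\<bar>indicator {0..\<tau>} (snd q) * v (fst q)\<bar> \<le> M" for q
        using v_bounded[of "fst q"] M_nonneg by (auto simp: indicator_def)
      show "indicator {0..\<tau>} (snd q) * v (fst q) = 0" if "q \<notin> Omega \<times> {0..\<tau>}" for q
        using that v_outside_Omega[of "fst q"] by (cases q) (auto simp: indicator_def)
      have "(\<lambda>q. indicator {0..\<tau>} (snd q) * v (fst q)) \<in> borel_measurable (lborel \<Otimes>\<^sub>M lborel)"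
        by measurable
      then show "(\<lambda>q. indicator {0..\<tau>} (snd q) * v (fst q)) \<in> borel_measurable lborel"
        by (simp add: lborel_prod)
    qed
    then show ?thesis
      unfolding lborel_prod k_def by (rule Bochner_Integration.integrable_cong[THEN iffD1, rotated 2]) auto
  qed
  have inner: "(\<integral>\<sigma>. k (p, \<sigma>) \<partial>lborel) = \<psi> p * v p - \<psi> (p - (\<tau>, 0)) * v p" for p
  proof -
    obtain s z where p: "p = (s, z)" by (cases p)
    have "(\<integral>\<sigma>. \<psi>s (s - \<sigma>, z) * indicator {0..\<tau>} \<sigma> \<partial>lborel) = - \<psi> (s - \<tau>, z) - - \<psi> (s - 0, z)"
    proof (rule integral_FTC_Icc_real[OF \<tau>])
      fix \<sigma> :: real
      have 1: "((\<lambda>\<sigma>. (s - \<sigma>, z)) has_derivative (\<lambda>h. (- h, 0))) (at \<sigma>)"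
        by (auto intro!: derivative_eq_intros)
      have "((\<lambda>\<sigma>. - \<psi> (s - \<sigma>, z)) has_derivative (\<lambda>h. h * \<psi>s (s - \<sigma>, z))) (at \<sigma>)"
        by (rule has_derivative_eq_rhs[OF has_derivative_minus[OF has_derivative_compose[OF 1 C1_partials_has_derivative[OF \<psi>]]]])
          (simp add: fun_eq_iff)
      then show "((\<lambda>\<sigma>. - \<psi> (s - \<sigma>, z)) has_real_derivative \<psi>s (s - \<sigma>, z)) (at \<sigma>)"
        by (simp add: has_field_derivative_def mult.commute[of _ "\<psi>s _"])
      have "continuous_on UNIV (\<lambda>\<sigma>. \<psi>s (s - \<sigma>, z))"
        by (intro continuous_on_compose2[OF c\<psi>s] continuous_intros) auto
      then show "isCont (\<lambda>\<sigma>. \<psi>s (s - \<sigma>, z)) \<sigma>"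
        by (simp add: continuous_on_eq_continuous_at)
    qed
    moreover have "(\<integral>\<sigma>. k (p, \<sigma>) \<partial>lborel) = (\<integral>\<sigma>. v p * (\<psi>s (s - \<sigma>, z) * indicator {0..\<tau>} \<sigma>) \<partial>lborel)"
      by (intro Bochner_Integration.integral_cong) (auto simp: k_def p)
    ultimately have "(\<integral>\<sigma>. k (p, \<sigma>) \<partial>lborel) = v p * (- \<psi> (s - \<tau>, z) - - \<psi> (s - 0, z))"
      by (simp only: integral_mult_right_zero)
    then show ?thesis by (simp add: p algebra_simps)
  qed
  have slice: "(\<integral>p. k (p, \<sigma>) \<partial>lborel) \<le> indicator {0..\<tau>} \<sigma> * (K * T)" for \<sigma>
  proof (cases "\<sigma> \<in> {0..\<tau>}")
    case True
    have C: "C1_partials (\<lambda>p. \<psi> (fst p - \<sigma>, snd p)) (\<lambda>p. 1 * \<psi>s (fst p - \<sigma>, snd p)) (\<lambda>p. \<psi>z (fst p - \<sigma>, snd p))"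
      by (rule C1_partials_reparam_fst[OF \<psi>, of "\<lambda>x. x - \<sigma>" "\<lambda>_. 1"]) (auto intro!: derivative_eq_intros)
    have Z: "clear_of_axis_and_ends \<epsilon> (\<lambda>p. \<psi> (fst p - \<sigma>, snd p))"
      using \<epsilon>(2) True unfolding clear_of_axis_and_ends_def by auto
    have "\<bar>\<psi> (fst p - \<sigma>, snd p)\<bar> \<le> K" if p: "p \<in> Omega" for p
    proof (cases "fst p - \<sigma> \<le> \<epsilon>")
      case True
      then show ?thesis using \<epsilon>(2) K0 unfolding clear_of_axis_and_ends_def by simp
    next
      case False
      then have "(fst p - \<sigma>, snd p) \<in> Omega" using p \<epsilon>(1) \<open>\<sigma> \<in> {0..\<tau>}\<close> by (auto simp: Omega_def)
      then show ?thesis by (rule K)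
    qed
    then have "(\<integral>p. v p * (1 * \<psi>s (fst p - \<sigma>, snd p)) \<partial>lborel) \<le> K * T"
      using v_variation[unfolded radial_variation_le_def, rule_format, OF C \<epsilon>(1) Z K0] by blast
    also have "(\<integral>p. v p * (1 * \<psi>s (fst p - \<sigma>, snd p)) \<partial>lborel) = (\<integral>p. k (p, \<sigma>) \<partial>lborel)"
      using True by (intro Bochner_Integration.integral_cong) (auto simp: k_def minus_prod_def)
    finally show ?thesis using True by simp
  qed (simp add: k_def)
  have "(\<integral>p. \<psi> p * (v p - v (p + (\<tau>, 0))) \<partial>lborel) = (\<integral>p. \<psi> p * v p \<partial>lborel) - (\<integral>p. \<psi> p * v (p + (\<tau>, 0)) \<partial>lborel)"
    by (simp add: right_diff_distrib i1 i2')
  also have "(\<integral>p. \<psi> p * v (p + (\<tau>, 0)) \<partial>lborel) = (\<integral>p. \<psi> (p + (\<tau>, 0) - (\<tau>, 0)) * v (p + (\<tau>, 0)) \<partial>lborel)"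
    by simp
  also have "\<dots> = (\<integral>p. \<psi> (p - (\<tau>, 0)) * v p \<partial>lborel)"
    by (rule lborel_integral_translate) simp
  also have "(\<integral>p. \<psi> p * v p \<partial>lborel) - \<dots> = (\<integral>p. \<integral>\<sigma>. k (p, \<sigma>) \<partial>lborel \<partial>lborel)"
    by (simp add: inner i1 i2)
  also have "\<dots> = (\<integral>\<sigma>. \<integral>p. k (p, \<sigma>) \<partial>lborel \<partial>lborel)"
    using lborel_pair.Fubini_integral[of "\<lambda>p \<sigma>. k (p, \<sigma>)"] ki by simp
  also have "\<dots> \<le> (\<integral>\<sigma>. indicator {0..\<tau>} \<sigma> * (K * T) \<partial>lborel)"
  proof (rule integral_mono[OF _ _ slice])
    show "integrable lborel (\<lambda>\<sigma>. \<integral>p. k (p, \<sigma>) \<partial>lborel)"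
      using lborel_pair.integrable_snd[of "\<lambda>p \<sigma>. k (p, \<sigma>)"] ki by simp
  qed (rule integrable_indicator_mult_const, auto)
  also have "\<dots> = \<tau> * (K * T)" using \<tau> by simp
  finally show ?thesis .
qed

text \<open>The bounded approximations of \<open>v\<close> are used as test functions; dominated convergence yields
  \<open>v\<close> itself as the first factor. This replaces the estimate of the \<open>L\<^sup>1\<close> modulus of continuity of a
  function of bounded variation.\<close>

lemma variation_shift_self:
  assumes \<tau>: "0 \<le> \<tau>"
  shows "(\<integral>p. v p * (v p - v (p + (\<tau>, 0))) \<partial>lborel) \<le> \<tau> * (M * T)"
proof -
  have vl: "v \<in> borel_measurable lborel" by simp
  obtain \<psi> \<psi>s \<psi>z \<epsilon> where \<psi>: "\<And>n::nat. C1_partials (\<psi> n) (\<psi>s n) (\<psi>z n)"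
    and bd: "\<And>n p. p \<in> Omega \<Longrightarrow> \<bar>\<psi> n p\<bar> \<le> M + 1 / real (Suc n)"
    and \<epsilon>: "\<And>n. 0 < \<epsilon> n" "\<And>n. clear_of_axis_and_ends (\<epsilon> n) (\<psi> n)"
    and lim: "AE p in lborel. p \<in> {0<..1} \<times> {-1<..<1} \<longrightarrow> (\<lambda>n. \<psi> n p) \<longlonglongrightarrow> v p"
    by (rule C1_approximation_AE[OF vl v_bounded]) (rule that)
  have [measurable]: "\<psi> n \<in> borel_measurable borel" for n
    using C1_partials_continuous[OF \<psi>] by (rule borel_measurable_continuous_onI)
  let ?d = "\<lambda>p. v p - v (p + (\<tau>, 0))"
  have d0: "?d p = 0" if "1 < fst p \<or> \<bar>snd p\<bar> \<ge> 1" for p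
    using that \<tau> v_support[of p] v_support[of "p + (\<tau>, 0)"]
    by (cases p) (auto simp: abs_if split: if_splits)
  have \<psi>0: "\<psi> n p = 0" if "fst p \<le> 0" for n p
    using \<epsilon>(1)[of n] \<epsilon>(2)[of n] that unfolding clear_of_axis_and_ends_def by (cases p) auto
  have "(\<lambda>n. \<integral>p. \<psi> n p * ?d p \<partial>lborel) \<longlonglongrightarrow> (\<integral>p. v p * ?d p \<partial>lborel)"
  proof (rule integral_dominated_convergence[where w = "\<lambda>p. indicator Omega p * ((M + 1) * (2 * M))"])
    show "integrable lborel (\<lambda>p. indicator Omega p * ((M + 1) * (2 * M)))"
      using compact_Omega
      by (intro integrable_indicator_mult_const) (auto simp: borel_compact compact_imp_bounded)
    show "AE p in lborel. (\<lambda>n. \<psi> n p * ?d p) \<longlonglongrightarrow> v p * ?d p"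
      using lim
    proof eventually_elim
      case (elim p)
      consider "fst p \<le> 0" | "1 < fst p \<or> \<bar>snd p\<bar> \<ge> 1" | "p \<in> {0<..1} \<times> {-1<..<1}"
      proof -
        have "fst p \<le> 0 \<or> (1 < fst p \<or> \<bar>snd p\<bar> \<ge> 1) \<or> p \<in> {0<..1} \<times> {-1<..<1}"
          by (cases p) (simp add: abs_less_iff not_le, linarith)
        then show ?thesis using that by blast
      qed
      then show ?case
      proof cases
        case 1
        then have "v p = 0" by (intro v_support) (cases p, auto)
        then show ?thesis using \<psi>0[OF 1] by simp
      qed (use elim d0 in \<open>auto intro!: tendsto_intros\<close>)
    qed
    show "AE p in lborel. norm (\<psi> n p * ?d p) \<le> indicator Omega p * ((M + 1) * (2 * M))" for n
    proof (intro always_eventually allI)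
      fix p
      show "norm (\<psi> n p * ?d p) \<le> indicator Omega p * ((M + 1) * (2 * M))"
      proof (cases "p \<in> Omega")
        case True
        have "M + 1 / real (Suc n) \<le> M + 1" by simp
        then have "\<bar>\<psi> n p\<bar> \<le> M + 1" using bd[OF True, of n] by linarith
        moreover have "\<bar>?d p\<bar> \<le> 2 * M" using v_bounded[of p] v_bounded[of "p + (\<tau>, 0)"] by linarith
        ultimately have "\<bar>\<psi> n p\<bar> * \<bar>?d p\<bar> \<le> (M + 1) * (2 * M)" using M_nonneg by (intro mult_mono) auto
        then show ?thesis using True by (simp add: abs_mult)
      next
        case False
        then have "fst p \<le> 0 \<or> 1 < fst p \<or> \<bar>snd p\<bar> \<ge> 1" by (cases p) (auto simp: Omega_def)
        then have "\<psi> n p * ?d p = 0" using \<psi>0[of p n] d0[of p] by auto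
        then show ?thesis using False by simp
      qed
    qed
  qed measurable
  moreover have "(\<lambda>n. \<tau> * ((M + 1 / real (Suc n)) * T)) \<longlonglongrightarrow> \<tau> * ((M + 0) * T)"
    by (intro tendsto_intros LIMSEQ_Suc[OF lim_1_over_n])
  ultimately have "(\<integral>p. v p * ?d p \<partial>lborel) \<le> \<tau> * ((M + 0) * T)"
  proof (rule LIMSEQ_le)
    show "\<exists>N. \<forall>n\<ge>N. (\<integral>p. \<psi> n p * ?d p \<partial>lborel) \<le> \<tau> * ((M + 1 / real (Suc n)) * T)"
      using M_nonneg
      by (intro exI[of _ 0] allI impI variation_shift_C1[OF \<psi> \<epsilon> _ bd \<tau>] add_nonneg_pos) auto
  qed
  then show ?thesis by simp
qed

definition G :: "real \<times> real \<Rightarrow> real" where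
  "G = (\<lambda>(s, z). tail_integral (\<lambda>s. v (s, z)) s)"

lemma G_measurable [measurable]: "G \<in> borel_measurable borel"
proof -
  have "(\<lambda>p. tail_integral (\<lambda>s. v (s, snd p)) (fst p)) \<in> borel_measurable (borel \<Otimes>\<^sub>M borel)"
    by measurable
  then show ?thesis by (simp add: G_def split_beta' borel_prod)
qed

lemma slice_integrable: "integrable lborel (\<lambda>\<sigma>. indicator A \<sigma> * v (\<sigma>, z))" if [measurable]: "A \<in> sets borel" for A
proof (rule integrable_bounded_of_bounded_support[where B=M and K="{0..1}"])
  fix \<sigma> assume "\<sigma> \<notin> {0..1::real}"
  then show "indicator A \<sigma> * v (\<sigma>, z) = 0" using v_support[of "(\<sigma>, z)"] by auto
next
  show "\<bar>indicator A \<sigma> * v (\<sigma>, z)\<bar> \<le> M" for \<sigma>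
    using v_bounded[of "(\<sigma>, z)"] M_nonneg by (auto simp: indicator_def)
qed auto

lemma G_bounded: "\<bar>G p\<bar> \<le> M"
proof -
  obtain s z where p: "p = (s, z)" by (cases p)
  have "\<bar>G p\<bar> \<le> (\<integral>\<sigma>. \<bar>indicator {s<..} \<sigma> * v (\<sigma>, z)\<bar> \<partial>lborel)"
    unfolding G_def p tail_integral_def by (simp only: prod.case) (rule integral_abs_bound)
  also have "\<dots> \<le> (\<integral>\<sigma>. indicator {0..1::real} \<sigma> * M \<partial>lborel)"
  proof (rule integral_mono)
    show "integrable lborel (\<lambda>\<sigma>. \<bar>indicator {s<..} \<sigma> * v (\<sigma>, z)\<bar>)"
      by (intro integrable_abs slice_integrable) simp
    show "\<bar>indicator {s<..} \<sigma> * v (\<sigma>, z)\<bar> \<le> indicator {0..1} \<sigma> * M" for \<sigma>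
      using v_bounded[of "(\<sigma>, z)"] v_support[of "(\<sigma>, z)"] M_nonneg by (auto simp: indicator_def)
  qed (rule integrable_indicator_mult_const, auto)
  finally show ?thesis by simp
qed

lemma G_support: "G (s, z) = 0" if "1 \<le> s \<or> \<bar>z\<bar> \<ge> 1"
proof -
  have *: "indicator {s<..} \<sigma> * v (\<sigma>, z) = 0" for \<sigma>
    using that v_support[of "(\<sigma>, z)"] by (auto simp: indicator_def abs_if split: if_splits)
  show ?thesis unfolding G_def tail_integral_def prod.case * by simp
qed

lemma integral_shifts:
  assumes h: "0 < h"
  shows "(\<integral>\<tau>. indicator {0<..h} \<tau> * v (p + (\<tau>, 0)) \<partial>lborel) = G p - G (p + (h, 0))"
proof -
  obtain s z where p: "p = (s, z)" by (cases p)
  have "G p - G (p + (h, 0)) = (\<integral>\<sigma>. indicator {s<..} \<sigma> * v (\<sigma>, z) - indicator {s + h<..} \<sigma> * v (\<sigma>, z) \<partial>lborel)"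
    unfolding G_def tail_integral_def p by (simp add: slice_integrable)
  also have "\<dots> = (\<integral>\<sigma>. indicator {s<..s+h} \<sigma> * v (\<sigma>, z) \<partial>lborel)"
    using h by (intro Bochner_Integration.integral_cong) (auto simp: indicator_def)
  also have "\<dots> = (\<integral>\<tau>. indicator {s<..s+h} (s + \<tau>) * v (s + \<tau>, z) \<partial>lborel)"
    by (subst lborel_integral_real_affine[where c=1 and t=s]) auto
  also have "\<dots> = (\<integral>\<tau>. indicator {0<..h} \<tau> * v (p + (\<tau>, 0)) \<partial>lborel)"
    by (intro Bochner_Integration.integral_cong) (auto simp: indicator_def p)
  finally show ?thesis by simp
qed

text \<open>The previous bound, integrated over \<open>\<tau>\<close> in \<open>{0<..h}\<close>: the mean of the translates of \<open>v\<close> is a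
  difference quotient of \<open>G\<close>.\<close>

lemma squared_L2_le_averaged:
  assumes h: "0 < h"
  shows "h * (\<integral>p. (v p)\<^sup>2 \<partial>lborel) \<le> h * (h * (M * T)) + (\<integral>p. v p * (G p - G (p + (h, 0))) \<partial>lborel)"
proof -
  let ?N = "\<integral>p. (v p)\<^sup>2 \<partial>lborel"
  define c where "c \<tau> = (\<integral>p. v p * v (p + (\<tau>, 0)) \<partial>lborel)" for \<tau>
  define k where "k = (\<lambda>(p, \<tau>). v p * (indicator {0<..h} \<tau> * v (p + (\<tau>, 0))))"
  have vv: "\<bar>v p * v q\<bar> \<le> M * M" for p q
    unfolding abs_mult using v_bounded M_nonneg by (intro mult_mono) auto
  have i: "integrable lborel (\<lambda>p. v p * v (p + q))" for q
    by (rule integrable_bounded_of_bounded_support[OF _ vv compact_Omega]) (auto simp: v_outside_Omega)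
  have [measurable]: "k \<in> borel_measurable (lborel \<Otimes>\<^sub>M lborel)"
    unfolding k_def by measurable
  have ki: "integrable (lborel \<Otimes>\<^sub>M lborel) k"
    unfolding lborel_prod
  proof (rule integrable_bounded_of_bounded_support)
    show "compact (Omega \<times> {0..h})" by (intro compact_Times compact_Omega) auto
    show "k q = 0" if "q \<notin> Omega \<times> {0..h}" for q
      using that v_outside_Omega[of "fst q"] by (cases q) (auto simp: k_def indicator_def)
    show "\<bar>k q\<bar> \<le> M * M" for q
      using vv[of "fst q" "fst q + (snd q, 0)"] M_nonneg by (cases q) (auto simp: k_def indicator_def)
    have "k \<in> borel_measurable (lborel \<Otimes>\<^sub>M lborel)" by simp
    then show "k \<in> borel_measurable lborel" by (simp add: lborel_prod)
  qed
  have kc: "(\<integral>p. k (p, \<tau>) \<partial>lborel) = indicator {0<..h} \<tau> * c \<tau>" for \<tau>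
  proof -
    have "(\<integral>p. k (p, \<tau>) \<partial>lborel) = (\<integral>p. indicator {0<..h} \<tau> * (v p * v (p + (\<tau>, 0))) \<partial>lborel)"
      by (intro Bochner_Integration.integral_cong) (auto simp: k_def)
    then show ?thesis unfolding c_def by (simp only: integral_mult_right_zero)
  qed
  have ic: "integrable lborel (\<lambda>\<tau>. indicator {0<..h} \<tau> * c \<tau>)"
    using lborel_pair.integrable_snd[of "\<lambda>p \<tau>. k (p, \<tau>)"] ki by (simp add: kc)
  have ih: "integrable lborel (\<lambda>\<tau>. indicator {0<..h} \<tau> * a)" for a :: real
    by (rule integrable_indicator_mult_const) auto
  have ind: "(\<integral>\<tau>. indicator {0<..h} \<tau> * a \<partial>lborel) = h * a" for a :: real
    using h by simp
  have "h * ?N = (\<integral>\<tau>. indicator {0<..h} \<tau> * ?N \<partial>lborel)"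
    by (rule ind[symmetric])
  also have "(\<integral>\<tau>. indicator {0<..h} \<tau> * ?N \<partial>lborel) \<le> (\<integral>\<tau>. indicator {0<..h} \<tau> * (h * (M * T)) + indicator {0<..h} \<tau> * c \<tau> \<partial>lborel)"
  proof (intro integral_mono ih Bochner_Integration.integrable_add ic)
    fix \<tau> :: real
    show "indicator {0<..h} \<tau> * ?N \<le> indicator {0<..h} \<tau> * (h * (M * T)) + indicator {0<..h} \<tau> * c \<tau>"
    proof (cases "\<tau> \<in> {0<..h}")
      case True
      have "?N - c \<tau> = (\<integral>p. v p * (v p - v (p + (\<tau>, 0))) \<partial>lborel)"
        unfolding c_def using i[of 0] i[of "(\<tau>, 0)"] by (simp add: right_diff_distrib power2_eq_square)
      also have "\<dots> \<le> \<tau> * (M * T)" using True by (intro variation_shift_self) auto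
      also have "\<dots> \<le> h * (M * T)" using True M_nonneg T_nonneg by (intro mult_right_mono) auto
      finally show ?thesis using True by simp
    qed simp
  qed
  also have "\<dots> = h * (h * (M * T)) + (\<integral>\<tau>. \<integral>p. k (p, \<tau>) \<partial>lborel \<partial>lborel)"
    unfolding kc Bochner_Integration.integral_add[OF ih ic] ind ..
  finally have le: "h * ?N \<le> h * (h * (M * T)) + (\<integral>\<tau>. \<integral>p. k (p, \<tau>) \<partial>lborel \<partial>lborel)" .
  have "(\<integral>\<tau>. \<integral>p. k (p, \<tau>) \<partial>lborel \<partial>lborel) = (\<integral>p. \<integral>\<tau>. k (p, \<tau>) \<partial>lborel \<partial>lborel)"
    using lborel_pair.Fubini_integral[of "\<lambda>p \<tau>. k (p, \<tau>)"] ki by simp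
  also have "\<dots> = (\<integral>p. v p * (G p - G (p + (h, 0))) \<partial>lborel)"
    unfolding k_def prod.case integral_mult_right_zero integral_shifts[OF h] ..
  finally show ?thesis using le by linarith
qed

end

context bounded_area_profile begin

text \<open>Half of the squared norm of \<open>v\<close> is absorbed on the left after splitting the product of \<open>v\<close> and
  the increment of \<open>G\<close> by \<open>a (x - y) \<le> (h/2) a\<^sup>2 + (x\<^sup>2 + y\<^sup>2) / h\<close>. The translated \<open>G\<close> has no larger norm on the
  rectangle because \<open>G\<close> vanishes for \<open>s \<ge> 1\<close>.\<close>

lemma squared_L2_interpolation:
  assumes h: "0 < h"
  shows "(\<integral>p. (v p)\<^sup>2 \<partial>lborel) \<le> 2 * h * (M * T) + 4 / h\<^sup>2 * (\<integral>p. indicator ({0<..<1} \<times> {-1<..<1}) p * (G p)\<^sup>2 \<partial>lborel)"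
proof -
  let ?R = "{0<..<1::real} \<times> {-1<..<1::real}" and ?N = "\<integral>p. (v p)\<^sup>2 \<partial>lborel"
  let ?\<Gamma> = "\<integral>p. indicator ?R p * (G p)\<^sup>2 \<partial>lborel"
  have R[measurable]: "?R \<in> sets borel" by (intro borel_open open_Times) auto
  have sq: "\<bar>a\<^sup>2\<bar> \<le> M\<^sup>2" if "\<bar>a\<bar> \<le> M" for a
    using power_mono[OF that, of 2] by simp
  have iv: "integrable lborel (\<lambda>p. (v p)\<^sup>2)"
    by (rule integrable_bounded_of_bounded_support[OF _ sq[OF v_bounded] compact_Omega]) (auto simp: v_outside_Omega)
  have iG: "integrable lborel (\<lambda>p. indicator ?R p * (G (p + q))\<^sup>2)" for q
  proof (rule integrable_bounded_of_bounded_support[OF _ _ compact_Omega])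
    show "\<bar>indicator ?R p * (G (p + q))\<^sup>2\<bar> \<le> M\<^sup>2" for p
      using sq[OF G_bounded[of "p + q"]] by (auto simp: indicator_def)
  qed (auto simp: Omega_def indicator_def)
  have iG0: "integrable lborel (\<lambda>p. indicator ?R p * (G p)\<^sup>2)" using iG[of 0] by simp
  have ivG: "integrable lborel (\<lambda>p. v p * (G p - G (p + (h, 0))))"
  proof (rule integrable_bounded_of_bounded_support[OF _ _ compact_Omega])
    show "\<bar>v p * (G p - G (p + (h, 0)))\<bar> \<le> M * (2 * M)" for p
      unfolding abs_mult using v_bounded[of p] G_bounded[of p] G_bounded[of "p + (h, 0)"] M_nonneg
      by (intro mult_mono) auto
  qed (auto simp: v_outside_Omega)
  have shifted: "(\<integral>p. indicator ?R p * (G (p + (h, 0)))\<^sup>2 \<partial>lborel) \<le> ?\<Gamma>"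
  proof -
    have "(\<integral>p. indicator ?R p * (G (p + (h, 0)))\<^sup>2 \<partial>lborel)
        \<le> (\<integral>p. indicator ?R (p + (h, 0)) * (G (p + (h, 0)))\<^sup>2 \<partial>lborel)"
    proof (rule integral_mono[OF iG])
      have "integrable (distr lborel borel ((+) (h, 0))) (\<lambda>p. indicator ?R p * (G p)\<^sup>2)"
        using iG0 by (simp add: lborel_distr_plus)
      then show "integrable lborel (\<lambda>p. indicator ?R (p + (h, 0)) * (G (p + (h, 0)))\<^sup>2)"
        by (subst (asm) integrable_distr_eq) (auto simp: add.commute)
      show "indicator ?R p * (G (p + (h, 0)))\<^sup>2 \<le> indicator ?R (p + (h, 0)) * (G (p + (h, 0)))\<^sup>2" for p
        using h G_support[of "fst p + h" "snd p"] by (cases p) (auto simp: indicator_def)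
    qed
    also have "\<dots> = ?\<Gamma>" by (rule lborel_integral_translate) measurable
    finally show ?thesis .
  qed
  have pointwise: "v p * (G p - G (p + (h, 0))) \<le> h / 2 * (v p)\<^sup>2 + 1 / h * (indicator ?R p * (G p)\<^sup>2 + indicator ?R p * (G (p + (h, 0)))\<^sup>2)" for p
  proof (cases "p \<in> ?R")
    case True
    have "a * (x - y) \<le> h / 2 * a\<^sup>2 + 1 / h * (x\<^sup>2 + y\<^sup>2)" for a x y :: real
    proof -
      \<comment> \<open>The two squares are the exact defect of the inequality, up to the factor \<open>2 * h\<close>.\<close>
      have "0 \<le> (h * a - (x - y))\<^sup>2 + (x + y)\<^sup>2" by simp
      also have "\<dots> = 2 * h * (h / 2 * a\<^sup>2 + 1 / h * (x\<^sup>2 + y\<^sup>2) - a * (x - y))"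
        using h by (simp add: field_simps power2_eq_square)
      finally show ?thesis using h by (simp add: zero_le_mult_iff)
    qed
    then show ?thesis using True by simp
  next
    case False
    then show ?thesis using v_support[OF False] by simp
  qed
  have "h * ?N \<le> h * (h * (M * T)) + (\<integral>p. v p * (G p - G (p + (h, 0))) \<partial>lborel)"
    by (rule squared_L2_le_averaged[OF h])
  also have "(\<integral>p. v p * (G p - G (p + (h, 0))) \<partial>lborel)
      \<le> (\<integral>p. h / 2 * (v p)\<^sup>2 + 1 / h * (indicator ?R p * (G p)\<^sup>2 + indicator ?R p * (G (p + (h, 0)))\<^sup>2) \<partial>lborel)"
    by (intro integral_mono pointwise ivG Bochner_Integration.integrable_add integrable_mult_right iv iG iG0)
  also have "\<dots> = h / 2 * ?N + 1 / h * (?\<Gamma> + (\<integral>p. indicator ?R p * (G (p + (h, 0)))\<^sup>2 \<partial>lborel))"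
    by (subst Bochner_Integration.integral_add)
      (auto intro!: integrable_mult_right Bochner_Integration.integrable_add iv iG iG0
        simp: Bochner_Integration.integral_add[OF iG0 iG])
  also have "\<dots> \<le> h / 2 * ?N + 1 / h * (?\<Gamma> + ?\<Gamma>)"
    using h shifted by (intro add_left_mono mult_left_mono) auto
  finally have "h / 2 * ?N \<le> h * (h * (M * T)) + 2 / h * ?\<Gamma>" by simp
  then have "2 / h * (h / 2 * ?N) \<le> 2 / h * (h * (h * (M * T)) + 2 / h * ?\<Gamma>)"
    using h by (intro mult_left_mono) auto
  then show ?thesis using h by (simp add: field_simps power2_eq_square)
qed

end

text \<open>The optimal \<open>h\<close> is \<open>(\<Phi> / A)\<^bsup>1/3\<^esup>\<close>. When one of the two terms is absent, letting \<open>h\<close> tend to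
  infinity or to 0 shows that \<open>N\<close> is not positive.\<close>

lemma optimise_cube_root:
  fixes N A \<Phi> :: real
  assumes N: "\<And>h. 0 < h \<Longrightarrow> N \<le> 2 * h * A + 2 / h\<^sup>2 * \<Phi>" and "0 \<le> A" "0 \<le> \<Phi>"
  shows "N \<le> 4 * A powr (2/3) * \<Phi> powr (1/3)"
proof (cases "A = 0 \<or> \<Phi> = 0")
  case True
  have "N \<le> 0"
  proof (rule ccontr)
    assume "\<not> N \<le> 0"
    then have pos: "0 < N" by simp
    show False
    proof (cases "A = 0")
      case True
      define h where "h = sqrt (4 * (\<Phi> + 1) / N)"
      have h: "h\<^sup>2 = 4 * (\<Phi> + 1) / N" "0 < h" using pos assms(3) by (auto simp: h_def)
      have "N \<le> 2 / h\<^sup>2 * \<Phi>" using N[OF h(2)] True by simp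
      also have "\<dots> = N * (\<Phi> / (2 * (\<Phi> + 1)))" using pos assms(3) by (simp add: h(1) field_simps)
      also have "\<dots> < N * 1" using pos assms(3) by (intro mult_strict_left_mono) (auto simp: field_simps)
      finally show False by simp
    next
      case False
      with True have "\<Phi> = 0" by simp
      moreover have "0 < N / (4 * (A + 1))" using pos assms(2) by simp
      ultimately have "N \<le> 2 * (N / (4 * (A + 1))) * A" using N by fastforce
      also have "\<dots> = N * (A / (2 * (A + 1)))" using assms(2) by (simp add: field_simps)
      also have "\<dots> < N * 1" using pos assms(2) by (intro mult_strict_left_mono) (auto simp: field_simps)
      finally show False by simp
    qed
  qed
  also have "0 \<le> 4 * A powr (2/3) * \<Phi> powr (1/3)" by simp
  finally show ?thesis .
next
  case False
  then have pos: "0 < A" "0 < \<Phi>" using assms by auto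
  define a b where "a = A powr (1/3)" and "b = \<Phi> powr (1/3)"
  have ab: "0 < a" "0 < b" using pos by (auto simp: a_def b_def)
  have cube: "x ^ 3 = y" if "x = y powr (1/3)" "0 < y" for x y :: real
    using that by (simp add: powr_powr flip: powr_numeral)
  have A: "A = a ^ 3" and \<Phi>: "\<Phi> = b ^ 3" using pos by (auto intro!: cube[symmetric] simp: a_def b_def)
  have "A powr (2/3) = a\<^sup>2"
    using pos by (simp add: a_def powr_powr flip: powr_numeral)
  then have rhs: "4 * A powr (2/3) * \<Phi> powr (1/3) = 4 * a\<^sup>2 * b" by (simp add: b_def)
  have "N \<le> 2 * (b / a) * A + 2 / (b / a)\<^sup>2 * \<Phi>" using ab by (intro N) simp
  also have "\<dots> = 4 * a\<^sup>2 * b"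
    unfolding A \<Phi> using ab by (simp add: field_simps power2_eq_square power3_eq_cube)
  finally show ?thesis unfolding rhs .
qed

context bounded_area_profile begin

definition F :: "real \<times> real \<Rightarrow> real" where
  "F = (\<lambda>(t, z). area_abel (\<lambda>s. v (s, z)) t)"

lemma F_measurable [measurable]: "F \<in> borel_measurable borel"
proof -
  have "(\<lambda>p. area_abel (\<lambda>s. v (s, snd p)) (fst p)) \<in> borel_measurable (borel \<Otimes>\<^sub>M borel)"
    by measurable
  then show ?thesis by (simp add: F_def split_beta' borel_prod)
qed

lemma F_bounded:
  assumes t: "0 \<le> t"
  shows "\<bar>F (t, z)\<bar> \<le> 2 * M"
proof (cases "t \<le> 1")
  case True
  have "ennreal (norm (F (t, z))) \<le> (\<integral>\<^sup>+s. ennreal (norm (indicator {t<..} s * (v (s, z) / sqrt (s - t)))) \<partial>lborel)"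
  proof (cases "integrable lborel (\<lambda>s. indicator {t<..} s * (v (s, z) / sqrt (s - t)))")
    case True
    then show ?thesis
      unfolding F_def area_abel_def prod.case by (rule integral_norm_bound_ennreal)
  next
    case False
    then show ?thesis
      unfolding F_def area_abel_def prod.case by (simp add: not_integrable_integral_eq)
  qed
  also have "\<dots> \<le> (\<integral>\<^sup>+s. ennreal M * (ennreal (1 / sqrt (s - t)) * indicator {t<..<1} s) \<partial>lborel)"
  proof (rule nn_integral_mono)
    fix s
    show "ennreal (norm (indicator {t<..} s * (v (s, z) / sqrt (s - t)))) \<le> ennreal M * (ennreal (1 / sqrt (s - t)) * indicator {t<..<1} s)"
    proof (cases "s \<in> {t<..<1}")
      case True
      then have "norm (indicator {t<..} s * (v (s, z) / sqrt (s - t))) \<le> M * (1 / sqrt (s - t))"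
        using v_bounded[of "(s, z)"] by (simp add: divide_right_mono)
      then show ?thesis using True M_nonneg by (simp add: ennreal_mult[symmetric] ennreal_leI)
    next
      case False
      then show ?thesis using v_support[of "(s, z)"] by (auto simp: indicator_def)
    qed
  qed
  also have "\<dots> = ennreal M * ennreal (2 * sqrt (1 - t))"
    by (simp add: nn_integral_cmult nn_integral_inverse_sqrt[OF True])
  also have "\<dots> = ennreal (M * (2 * sqrt (1 - t)))" using M_nonneg by (intro ennreal_mult'[symmetric])
  also have "\<dots> \<le> ennreal (M * 2)"
    using M_nonneg t True by (intro ennreal_leI mult_left_mono) auto
  finally show ?thesis using M_nonneg by (subst (asm) ennreal_le_iff) auto
next
  case False
  then have *: "indicator {t<..} s * (v (s, z) / sqrt (s - t)) = 0" for s
    using v_support[of "(s, z)"] by (auto simp: indicator_def)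
  show ?thesis unfolding F_def area_abel_def prod.case * using M_nonneg by simp
qed

lemma squared_L2_G_le_F:
  "ennreal (pi\<^sup>2) * (\<integral>\<^sup>+p. ennreal ((G p)\<^sup>2) * indicator ({0<..<1} \<times> {-1<..<1}) p \<partial>lborel)
   \<le> 4 * (\<integral>\<^sup>+p. ennreal ((F p)\<^sup>2) * indicator ({0<..<1} \<times> {-1<..<1}) p \<partial>lborel)"
proof -
  have slices: "(\<integral>\<^sup>+p. ennreal ((H p)\<^sup>2) * indicator ({0<..<1} \<times> {-1<..<1}) p \<partial>lborel)
      = (\<integral>\<^sup>+z. (\<integral>\<^sup>+s. ennreal ((H (s, z))\<^sup>2) * indicator {0<..<1} s \<partial>lborel) * indicator {-1<..<1} z \<partial>lborel)"
    if [measurable]: "H \<in> borel_measurable borel" for H :: "real \<times> real \<Rightarrow> real"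
  proof -
    have "(\<integral>\<^sup>+p. ennreal ((H p)\<^sup>2) * indicator ({0<..<1} \<times> {-1<..<1}) p \<partial>lborel)
        = (\<integral>\<^sup>+z. \<integral>\<^sup>+s. ennreal ((H (s, z))\<^sup>2) * indicator ({0<..<1} \<times> {-1<..<1}) (s, z) \<partial>lborel \<partial>lborel)"
    proof -
      have [measurable]: "{0<..<1::real} \<times> {-1<..<1::real} \<in> sets borel" by (intro borel_open open_Times) auto
      have "(\<lambda>p. ennreal ((H p)\<^sup>2) * indicator ({0<..<1} \<times> {-1<..<1}) p) \<in> borel_measurable lborel"
        by measurable
      then show ?thesis
        unfolding lborel_prod[symmetric] by (rule lborel_pair.nn_integral_snd[symmetric])
    qed
    also have "\<dots> = (\<integral>\<^sup>+z. (\<integral>\<^sup>+s. ennreal ((H (s, z))\<^sup>2) * indicator {0<..<1} s \<partial>lborel) * indicator {-1<..<1} z \<partial>lborel)"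
      by (intro nn_integral_cong, subst nn_integral_multc[symmetric])
         (auto simp: indicator_times mult.assoc)
    finally show ?thesis .
  qed
  have m: "(\<lambda>s. v (s, z)) \<in> borel_measurable borel" for z by measurable
  have slice: "ennreal (pi\<^sup>2) * (\<integral>\<^sup>+s. ennreal ((G (s, z))\<^sup>2) * indicator {0<..<1} s \<partial>lborel)
      \<le> 4 * (\<integral>\<^sup>+s. ennreal ((F (s, z))\<^sup>2) * indicator {0<..<1} s \<partial>lborel)" for z
    unfolding G_def F_def prod.case
    by (rule tail_integral_L2_le_area_abel_L2[OF m v_bounded]) (auto intro: v_support)
  show ?thesis
    unfolding slices[OF G_measurable] slices[OF F_measurable]
    by (subst (1 2) nn_integral_cmult[symmetric], measurable)
       (auto intro!: nn_integral_mono mult_right_mono slice simp: mult.assoc[symmetric])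
qed

lemma squared_L2_le_abel:
  assumes \<Phi>: "(\<integral>\<^sup>+p. ennreal ((F p)\<^sup>2) * indicator ({0<..<1} \<times> {-1<..<1}) p \<partial>lborel) \<le> ennreal \<Phi>" "0 \<le> \<Phi>"
  shows "(\<integral>p. (v p)\<^sup>2 \<partial>lborel) \<le> 4 * (M * T) powr (2/3) * \<Phi> powr (1/3)"
proof (rule optimise_cube_root)
  let ?R = "{0<..<1::real} \<times> {-1<..<1::real}"
  let ?\<Gamma> = "\<integral>p. indicator ?R p * (G p)\<^sup>2 \<partial>lborel"
  have R[measurable]: "?R \<in> sets borel" by (intro borel_open open_Times) auto
  have "ennreal ?\<Gamma> \<le> (\<integral>\<^sup>+p. ennreal (indicator ?R p * (G p)\<^sup>2) \<partial>lborel)"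
  proof (cases "integrable lborel (\<lambda>p. indicator ?R p * (G p)\<^sup>2)")
    case True
    then show ?thesis by (subst nn_integral_eq_integral) auto
  qed (simp add: not_integrable_integral_eq)
  also have "\<dots> = (\<integral>\<^sup>+p. ennreal ((G p)\<^sup>2) * indicator ?R p \<partial>lborel)"
    by (intro nn_integral_cong) (auto simp: indicator_def)
  finally have "ennreal (pi\<^sup>2) * ennreal ?\<Gamma> \<le> ennreal (pi\<^sup>2) * \<dots>"
    by (rule mult_left_mono) simp
  also note squared_L2_G_le_F
  also have "4 * (\<integral>\<^sup>+p. ennreal ((F p)\<^sup>2) * indicator ?R p \<partial>lborel) \<le> 4 * ennreal \<Phi>"
    using \<Phi> by (intro mult_left_mono) auto
  also have "4 * ennreal \<Phi> = ennreal (4 * \<Phi>)" using \<Phi>(2) by (simp add: ennreal_mult')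
  finally have "ennreal (pi\<^sup>2 * ?\<Gamma>) \<le> ennreal (4 * \<Phi>)" by (simp add: ennreal_mult')
  then have pi\<Gamma>: "pi\<^sup>2 * ?\<Gamma> \<le> 4 * \<Phi>" using \<Phi>(2) by (subst (asm) ennreal_le_iff) auto
  \<comment> \<open>The factor \<open>4 / pi\<^sup>2\<close> is rounded up to \<open>1/2\<close>.\<close>
  have "3\<^sup>2 \<le> pi\<^sup>2" using pi_gt3 by (intro power_mono) auto
  then have "8 * ?\<Gamma> \<le> pi\<^sup>2 * ?\<Gamma>"
    by (intro mult_right_mono Bochner_Integration.integral_nonneg) auto
  with pi\<Gamma> have \<Gamma>: "4 * ?\<Gamma> \<le> 2 * \<Phi>" by linarith
  fix h :: real assume h: "0 < h"
  have "(\<integral>p. (v p)\<^sup>2 \<partial>lborel) \<le> 2 * h * (M * T) + 4 / h\<^sup>2 * ?\<Gamma>"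
    by (rule squared_L2_interpolation[OF h])
  also have "4 / h\<^sup>2 * ?\<Gamma> = (4 * ?\<Gamma>) / h\<^sup>2" by simp
  also have "2 * h * (M * T) + (4 * ?\<Gamma>) / h\<^sup>2 \<le> 2 * h * (M * T) + (2 * \<Phi>) / h\<^sup>2"
    using \<Gamma> by (intro add_left_mono divide_right_mono) auto
  finally show "(\<integral>p. (v p)\<^sup>2 \<partial>lborel) \<le> 2 * h * (M * T) + 2 / h\<^sup>2 * \<Phi>" by simp
qed (use M_nonneg T_nonneg \<Phi> in auto)

end

section \<open>Changes of variables\<close>

lemma nn_integral_square_substitution:
  fixes \<phi> :: "real \<Rightarrow> ennreal"
  assumes [measurable]: "\<phi> \<in> borel_measurable borel"
  shows "(\<integral>\<^sup>+s. \<phi> s * indicator {0..1} s \<partial>lborel) = (\<integral>\<^sup>+r. \<phi> (r\<^sup>2) * ennreal (2 * r) * indicator {0..1} r \<partial>lborel)"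
proof -
  have "(\<integral>\<^sup>+s. \<phi> s * indicator {0\<^sup>2..1\<^sup>2} s \<partial>lborel) = (\<integral>\<^sup>+r. \<phi> (r\<^sup>2) * ennreal (2 * r) * indicator {0..1} r \<partial>lborel)"
    by (rule nn_integral_substitution_aux) (auto intro!: derivative_eq_intros continuous_intros)
  then show ?thesis by simp
qed

text \<open>The substitution \<open>s = r\<^sup>2\<close> is stated as an identity of image measures, so that it serves for
  nonnegative integrands and for Bochner integrals of arbitrary measurable functions alike.\<close>

definition radial_measure :: "real measure" where
  "radial_measure = density lborel (\<lambda>r. ennreal (2 * r) * indicator {0..1} r)"

definition area_map :: "real \<times> real \<Rightarrow> real \<times> real" where
  "area_map p = ((fst p)\<^sup>2, snd p)"

lemma area_map_measurable [measurable]: "area_map \<in> borel_measurable borel"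
  unfolding area_map_def[abs_def] borel_prod[symmetric] by measurable

lemma distr_square: "distr radial_measure borel (\<lambda>r. r\<^sup>2) = density lborel (indicator {0..1})"
proof (rule measure_eqI)
  fix A assume "A \<in> sets (distr radial_measure borel (\<lambda>r. r\<^sup>2))"
  then have [measurable]: "A \<in> sets borel" by simp
  have "emeasure (distr radial_measure borel (\<lambda>r. r\<^sup>2)) A = (\<integral>\<^sup>+s. indicator A s \<partial>distr radial_measure borel (\<lambda>r. r\<^sup>2))"
    by simp
  also have "\<dots> = (\<integral>\<^sup>+r. indicator A (r\<^sup>2) \<partial>radial_measure)"
    by (intro nn_integral_distr) (auto simp: radial_measure_def)
  also have "\<dots> = (\<integral>\<^sup>+r. indicator A (r\<^sup>2) * ennreal (2 * r) * indicator {0..1} r \<partial>lborel)"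
    unfolding radial_measure_def by (subst nn_integral_density) (auto simp: ac_simps)
  also have "\<dots> = (\<integral>\<^sup>+s. indicator A s * indicator {0..1} s \<partial>lborel)"
    by (rule nn_integral_square_substitution[symmetric]) simp
  also have "\<dots> = emeasure (density lborel (indicator {0..1})) A"
    by (subst emeasure_density) (auto simp: ac_simps)
  finally show "emeasure (distr radial_measure borel (\<lambda>r. r\<^sup>2)) A = emeasure (density lborel (indicator {0..1})) A" .
qed (simp add: radial_measure_def)

lemma nn_integral_area_map:
  fixes \<phi> :: "real \<times> real \<Rightarrow> ennreal"
  assumes [measurable]: "\<phi> \<in> borel_measurable borel"
  shows "(\<integral>\<^sup>+p. \<phi> p * indicator ({0..1} \<times> UNIV) p \<partial>lborel)
       = (\<integral>\<^sup>+p. \<phi> (area_map p) * ennreal (2 * fst p) * indicator ({0..1} \<times> UNIV) p \<partial>lborel)"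
proof -
  have [measurable]: "{0..1::real} \<times> (UNIV :: real set) \<in> sets borel" by (intro borel_closed closed_Times) auto
  have slices: "(\<integral>\<^sup>+p. H p \<partial>lborel) = (\<integral>\<^sup>+z. \<integral>\<^sup>+s. H (s, z) \<partial>lborel \<partial>lborel)"
    if "H \<in> borel_measurable lborel" for H :: "real \<times> real \<Rightarrow> ennreal"
    using that unfolding lborel_prod[symmetric] by (rule lborel_pair.nn_integral_snd[symmetric])
  have [measurable]: "(\<lambda>s. \<phi> (s, z)) \<in> borel_measurable borel" for z by measurable
  have fm: "(fst :: real \<times> real \<Rightarrow> real) \<in> borel_measurable borel" unfolding borel_prod[symmetric] by measurable
  have m1: "(\<lambda>p. \<phi> p * indicator ({0..1} \<times> UNIV) p) \<in> borel_measurable lborel"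
    by (intro borel_measurable_times_ennreal borel_measurable_indicator) auto
  have m2: "(\<lambda>p. \<phi> (area_map p) * ennreal (2 * fst p) * indicator ({0..1} \<times> UNIV) p) \<in> borel_measurable lborel"
    using fm by (intro borel_measurable_times_ennreal borel_measurable_indicator) auto
  show ?thesis
    unfolding slices[OF m1] slices[OF m2]
  proof (rule nn_integral_cong)
    fix z :: real
    show "(\<integral>\<^sup>+s. \<phi> (s, z) * indicator ({0..1} \<times> UNIV) (s, z) \<partial>lborel)
       = (\<integral>\<^sup>+s. \<phi> (area_map (s, z)) * ennreal (2 * fst (s, z)) * indicator ({0..1} \<times> UNIV) (s, z) \<partial>lborel)"
      using nn_integral_square_substitution[of "\<lambda>s. \<phi> (s, z)"]
      by (simp add: area_map_def indicator_times)
  qed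
qed

definition radial_plane_measure :: "(real \<times> real) measure" where
  "radial_plane_measure = density lborel (\<lambda>p. ennreal (2 * fst p) * indicator ({0..1} \<times> UNIV) p)"

lemma distr_area_map: "distr radial_plane_measure borel area_map = density lborel (indicator ({0..1} \<times> UNIV))"
proof (rule measure_eqI)
  have [measurable]: "{0..1::real} \<times> (UNIV :: real set) \<in> sets borel" by (intro borel_closed closed_Times) auto
  have [measurable]: "(fst :: real \<times> real \<Rightarrow> real) \<in> borel_measurable borel" unfolding borel_prod[symmetric] by measurable
  fix A assume "A \<in> sets (distr radial_plane_measure borel area_map)"
  then have [measurable]: "A \<in> sets borel" by simp
  have "emeasure (distr radial_plane_measure borel area_map) A = (\<integral>\<^sup>+s. indicator A s \<partial>distr radial_plane_measure borel area_map)"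
    by simp
  also have "\<dots> = (\<integral>\<^sup>+r. indicator A (area_map r) \<partial>radial_plane_measure)"
    by (intro nn_integral_distr) (auto simp: radial_plane_measure_def)
  also have "\<dots> = (\<integral>\<^sup>+p. indicator A (area_map p) * ennreal (2 * fst p) * indicator ({0..1} \<times> UNIV) p \<partial>lborel)"
    unfolding radial_plane_measure_def by (subst nn_integral_density) (auto simp: ac_simps)
  also have "\<dots> = (\<integral>\<^sup>+p. indicator A p * indicator ({0..1} \<times> UNIV) p \<partial>lborel)"
    by (rule nn_integral_area_map[symmetric]) simp
  also have "\<dots> = emeasure (density lborel (indicator ({0..1} \<times> UNIV))) A"
    by (subst emeasure_density) (auto simp: ac_simps)
  finally show "emeasure (distr radial_plane_measure borel area_map) A = emeasure (density lborel (indicator ({0..1} \<times> UNIV))) A" .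
qed (simp add: radial_plane_measure_def)

lemma integral_square_substitution:
  fixes f :: "real \<Rightarrow> real"
  assumes [measurable]: "f \<in> borel_measurable borel"
  shows "(\<integral>s. indicator {0..1} s * f s \<partial>lborel) = (\<integral>r. indicator {0..1} r * (2 * r * f (r\<^sup>2)) \<partial>lborel)"
proof -
  have "(\<integral>s. indicator {0..1} s * f s \<partial>lborel) = (\<integral>s. f s \<partial>density lborel (\<lambda>s. ennreal (indicator {0..1} s)))"
    by (subst integral_density) auto
  also have "\<dots> = (\<integral>s. f s \<partial>distr radial_measure borel (\<lambda>r. r\<^sup>2))"
    unfolding distr_square by (simp add: ennreal_indicator)
  also have "\<dots> = (\<integral>r. f (r\<^sup>2) \<partial>radial_measure)"
    by (intro integral_distr) (auto simp: radial_measure_def)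
  also have "radial_measure = density lborel (\<lambda>r. ennreal (2 * r * indicator {0..1} r))"
    unfolding radial_measure_def by (rule density_cong) (auto simp: indicator_def)
  also have "(\<integral>r. f (r\<^sup>2) \<partial>\<dots>) = (\<integral>r. (2 * r * indicator {0..1} r) *\<^sub>R f (r\<^sup>2) \<partial>lborel)"
    by (rule integral_density) (auto simp: indicator_def)
  also have "\<dots> = (\<integral>r. indicator {0..1} r * (2 * r * f (r\<^sup>2)) \<partial>lborel)"
    by (intro Bochner_Integration.integral_cong) auto
  finally show ?thesis .
qed

lemma integral_area_map:
  fixes f :: "real \<times> real \<Rightarrow> real"
  assumes [measurable]: "f \<in> borel_measurable borel"
  shows "(\<integral>p. indicator ({0..1} \<times> UNIV) p * f p \<partial>lborel)
       = (\<integral>p. indicator ({0..1} \<times> UNIV) p * (2 * fst p * f (area_map p)) \<partial>lborel)"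
proof -
  have [measurable]: "{0..1::real} \<times> (UNIV :: real set) \<in> sets borel" by (intro borel_closed closed_Times) auto
  have [measurable]: "(fst :: real \<times> real \<Rightarrow> real) \<in> borel_measurable borel" unfolding borel_prod[symmetric] by measurable
  have "(\<integral>s. indicator ({0..1} \<times> UNIV) s * f s \<partial>lborel) = (\<integral>s. f s \<partial>density lborel (\<lambda>s. ennreal (indicator ({0..1} \<times> UNIV) s)))"
    by (subst integral_density) auto
  also have "\<dots> = (\<integral>s. f s \<partial>distr radial_plane_measure borel area_map)"
    unfolding distr_area_map by (simp add: ennreal_indicator)
  also have "\<dots> = (\<integral>r. f (area_map r) \<partial>radial_plane_measure)"
    by (intro integral_distr) (auto simp: radial_plane_measure_def)
  also have "radial_plane_measure = density lborel (\<lambda>r. ennreal (2 * fst r * indicator ({0..1} \<times> UNIV) r))"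
    unfolding radial_plane_measure_def by (rule density_cong) (auto simp: indicator_def)
  also have "(\<integral>r. f (area_map r) \<partial>\<dots>) = (\<integral>r. (2 * fst r * indicator ({0..1} \<times> UNIV) r) *\<^sub>R f (area_map r) \<partial>lborel)"
    by (rule integral_density) (auto simp: indicator_def)
  also have "\<dots> = (\<integral>r. indicator ({0..1} \<times> UNIV) r * (2 * fst r * f (area_map r)) \<partial>lborel)"
    by (intro Bochner_Integration.integral_cong) auto
  finally show ?thesis .
qed

text \<open>Polar coordinates for functions of the radius: under the squared radius, the measure of
  the part of the unit disc outside radius \<open>sqrt x\<close> is \<open>pi (1 - x)\<close>, so the image of planar
  measure is \<open>pi\<close> times length.\<close>

lemma distr_disc_squared_radius:
  "distr (density lborel (indicator (cball (0 :: real \<times> real) 1))) borel (\<lambda>p. (fst p)\<^sup>2 + (snd p)\<^sup>2)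
     = density lborel (\<lambda>s. ennreal pi * indicator {0..1} s)" (is "?L = ?R")
proof (rule measure_eqI_lessThan)
  have [measurable]: "cball (0 :: real \<times> real) 1 \<in> sets borel" by simp
  have [measurable]: "(fst :: real \<times> real \<Rightarrow> real) \<in> borel_measurable borel"
      "(snd :: real \<times> real \<Rightarrow> real) \<in> borel_measurable borel" unfolding borel_prod[symmetric] by measurable
  have dist: "(fst p)\<^sup>2 + (snd p)\<^sup>2 = (norm p)\<^sup>2" for p :: "real \<times> real"
    by (simp add: norm_prod_def)
  have content: "emeasure lborel (cball (0 :: real \<times> real) r) = ennreal (pi * r\<^sup>2)" if "0 \<le> r" for r
    using that by (simp add: emeasure_cball unit_ball_vol_2 power2_eq_square)
  have L: "emeasure ?L {x<..} = ennreal (pi * (1 - max 0 (min 1 x)))" for x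
  proof -
    have "emeasure ?L {x<..} = emeasure (density lborel (indicator (cball (0 :: real \<times> real) 1))) {p. x < (norm p)\<^sup>2}"
      by (subst emeasure_distr) (auto simp: dist intro!: arg_cong[where f="emeasure _"])
    also have "\<dots> = emeasure lborel (cball (0 :: real \<times> real) 1 \<inter> {p. x < (norm p)\<^sup>2})"
      by (subst emeasure_density) (auto simp: nn_integral_indicator[symmetric] indicator_inter_arith simp del: nn_integral_indicator)
    also have "\<dots> = ennreal (pi * (1 - max 0 (min 1 x)))"
    proof (cases "x < 0 \<or> x \<ge> 1")
      case True
      then show ?thesis
      proof
        assume x: "x < 0"
        then have "cball (0 :: real \<times> real) 1 \<inter> {p. x < (norm p)\<^sup>2} = cball 0 1"
          by (auto intro: less_le_trans)
        then show ?thesis using x content[of 1] by simp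
      next
        assume x: "x \<ge> 1"
        have "(norm p)\<^sup>2 \<le> 1" if "norm p \<le> 1" for p :: "real \<times> real" using that by (intro power_le_one) auto
        then have "cball (0 :: real \<times> real) 1 \<inter> {p. x < (norm p)\<^sup>2} = {}"
          using x by (force simp: not_less)
        then show ?thesis using x by simp
      qed
    next
      case False
      then have x: "0 \<le> x" "x < 1" by auto
      have "norm p \<le> sqrt x \<longleftrightarrow> (norm p)\<^sup>2 \<le> x" for p :: "real \<times> real"
        by (metis norm_ge_zero real_sqrt_abs real_sqrt_le_iff abs_norm_cancel)
      then have "cball (0 :: real \<times> real) 1 \<inter> {p. x < (norm p)\<^sup>2} = cball 0 1 - cball 0 (sqrt x)"
        by (auto simp: not_le)
      also have "emeasure lborel \<dots> = emeasure lborel (cball (0 :: real \<times> real) 1) - emeasure lborel (cball (0 :: real \<times> real) (sqrt x))"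
        using x by (intro emeasure_Diff subset_cball) (auto simp: content)
      also have "\<dots> = ennreal (pi - pi * x)"
        using x content[of 1] content[of "sqrt x"] by (simp add: ennreal_minus)
      finally show ?thesis using x by (simp add: algebra_simps)
    qed
    finally show ?thesis .
  qed
  have R: "emeasure ?R {x<..} = ennreal (pi * (1 - max 0 (min 1 x)))" for x
  proof -
    have "emeasure ?R {x<..} = ennreal pi * emeasure lborel ({0..1} \<inter> {x<..})"
      by (subst emeasure_density) (auto simp: mult.assoc nn_integral_cmult indicator_inter_arith[symmetric])
    also have "emeasure lborel ({0..1} \<inter> {x<..}) = ennreal (1 - max 0 (min 1 x))"
    proof -
      consider "x < 0" | "0 \<le> x" "x < 1" | "1 \<le> x" by linarith
      then show ?thesis
      proof cases
        case 1
        then have "{0..1} \<inter> {x<..} = {0..1}" by auto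
        then show ?thesis using 1 by simp
      next
        case 2
        then have "{0..1} \<inter> {x<..} = {x<..1}" by auto
        then show ?thesis using 2 by simp
      next
        case 3
        then have "{0..1} \<inter> {x<..} = {}" by auto
        then show ?thesis using 3 by simp
      qed
    qed
    finally show ?thesis by (simp add: ennreal_mult')
  qed
  show "emeasure ?L {x<..} = emeasure ?R {x<..}" "emeasure ?L {x<..} < \<infinity>" for x
    unfolding L R by auto
qed auto

lemma nn_integral_disc:
  fixes \<phi> :: "real \<Rightarrow> ennreal"
  assumes [measurable]: "\<phi> \<in> borel_measurable borel"
  shows "(\<integral>\<^sup>+x. \<integral>\<^sup>+y. \<phi> (x\<^sup>2 + y\<^sup>2) * indicator {..1} (x\<^sup>2 + y\<^sup>2) \<partial>lborel \<partial>lborel) = ennreal pi * (\<integral>\<^sup>+s. \<phi> s * indicator {0..1} s \<partial>lborel)"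
proof -
  have [measurable]: "(fst :: real \<times> real \<Rightarrow> real) \<in> borel_measurable borel"
      "(snd :: real \<times> real \<Rightarrow> real) \<in> borel_measurable borel" unfolding borel_prod[symmetric] by measurable
  have [measurable]: "cball (0 :: real \<times> real) 1 \<in> sets borel" by simp
  have ball: "indicator (cball 0 1) p = (indicator {..1} ((fst p)\<^sup>2 + (snd p)\<^sup>2) :: ennreal)" for p :: "real \<times> real"
    by (simp add: indicator_def norm_prod_def)
  let ?h = "\<lambda>p::real\<times>real. \<phi> ((fst p)\<^sup>2 + (snd p)\<^sup>2) * indicator {..1} ((fst p)\<^sup>2 + (snd p)\<^sup>2)"
  have "?h \<in> borel_measurable lborel" by simp
  then have "(\<integral>\<^sup>+x. \<integral>\<^sup>+y. \<phi> (x\<^sup>2 + y\<^sup>2) * indicator {..1} (x\<^sup>2 + y\<^sup>2) \<partial>lborel \<partial>lborel) = (\<integral>\<^sup>+p. ?h p \<partial>lborel)"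
    unfolding lborel_prod[symmetric] by (subst lborel.nn_integral_fst[symmetric]) simp_all
  also have "\<dots> = (\<integral>\<^sup>+p. \<phi> ((fst p)\<^sup>2 + (snd p)\<^sup>2) \<partial>density lborel (indicator (cball (0 :: real \<times> real) 1)))"
    by (subst nn_integral_density) (auto simp: ball mult.commute)
  also have "\<dots> = (\<integral>\<^sup>+s. \<phi> s \<partial>distr (density lborel (indicator (cball (0 :: real \<times> real) 1))) borel (\<lambda>p. (fst p)\<^sup>2 + (snd p)\<^sup>2))"
    by (rule nn_integral_distr[symmetric]) auto
  also have "\<dots> = (\<integral>\<^sup>+s. ennreal pi * indicator {0..1} s * \<phi> s \<partial>lborel)"
    unfolding distr_disc_squared_radius by (rule nn_integral_density) auto
  also have "\<dots> = ennreal pi * (\<integral>\<^sup>+s. \<phi> s * indicator {0..1} s \<partial>lborel)"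
    by (subst nn_integral_cmult[symmetric]) (auto simp: ac_simps)
  finally show ?thesis .
qed

lemma nn_integral_cylinder:
  fixes \<phi> :: "real \<times> real \<Rightarrow> ennreal"
  assumes \<phi>[measurable]: "\<phi> \<in> borel_measurable borel"
  shows "(\<integral>\<^sup>+p. \<phi> ((fst p)\<^sup>2 + (fst (snd p))\<^sup>2, snd (snd p)) * indicator {..1} ((fst p)\<^sup>2 + (fst (snd p))\<^sup>2) \<partial>lborel)
    = ennreal pi * (\<integral>\<^sup>+p. \<phi> p * indicator ({0..1} \<times> UNIV) p \<partial>lborel)"
proof -
  let ?k = "\<lambda>x y z. \<phi> (x\<^sup>2 + y\<^sup>2, z) * indicator {..1} (x\<^sup>2 + y\<^sup>2)"
  have k[measurable]: "(\<lambda>p :: real \<times> real \<times> real. ?k (fst p) (fst (snd p)) (snd (snd p))) \<in> borel_measurable (lborel \<Otimes>\<^sub>M lborel \<Otimes>\<^sub>M lborel)"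
    by measurable
  have [measurable]: "(\<lambda>s. \<phi> (s, z)) \<in> borel_measurable borel" for z by measurable
  have R[measurable]: "{0..1::real} \<times> (UNIV :: real set) \<in> sets borel" by (intro borel_closed closed_Times) auto
  have k': "(\<lambda>p. ?k (fst p) (fst (snd p)) (snd (snd p))) \<in> borel_measurable (lborel \<Otimes>\<^sub>M (lborel :: (real \<times> real) measure))"
    using k by (simp only: lborel_prod)
  have "(\<integral>\<^sup>+p. ?k (fst p) (fst (snd p)) (snd (snd p)) \<partial>lborel)
      = (\<integral>\<^sup>+p. ?k (fst p) (fst (snd p)) (snd (snd p)) \<partial>(lborel \<Otimes>\<^sub>M (lborel :: (real \<times> real) measure)))"
    by (simp only: lborel_prod)
  also have "\<dots> = (\<integral>\<^sup>+x. \<integral>\<^sup>+q. ?k x (fst q) (snd q) \<partial>lborel \<partial>lborel)"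
    using lborel.nn_integral_fst[OF k'] by simp
  also have "\<dots> = (\<integral>\<^sup>+x. \<integral>\<^sup>+q. ?k x (fst q) (snd q) \<partial>(lborel \<Otimes>\<^sub>M lborel) \<partial>lborel)"
    by (simp only: lborel_prod)
  also have "\<dots> = (\<integral>\<^sup>+x. \<integral>\<^sup>+z. \<integral>\<^sup>+y. ?k x y z \<partial>lborel \<partial>lborel \<partial>lborel)"
    by (intro nn_integral_cong, subst lborel_pair.nn_integral_snd[symmetric]) simp_all
  also have "\<dots> = (\<integral>\<^sup>+z. \<integral>\<^sup>+x. \<integral>\<^sup>+y. ?k x y z \<partial>lborel \<partial>lborel \<partial>lborel)"
    by (rule lborel_pair.Fubini') measurable
  also have "\<dots> = (\<integral>\<^sup>+z. ennreal pi * (\<integral>\<^sup>+s. \<phi> (s, z) * indicator {0..1} s \<partial>lborel) \<partial>lborel)"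
    by (intro nn_integral_cong nn_integral_disc) simp
  also have "\<dots> = ennreal pi * (\<integral>\<^sup>+z. \<integral>\<^sup>+s. \<phi> (s, z) * indicator ({0..1} \<times> UNIV) (s, z) \<partial>lborel \<partial>lborel)"
    by (subst nn_integral_cmult[symmetric]) (auto simp: indicator_times)
  also have "(\<integral>\<^sup>+z. \<integral>\<^sup>+s. \<phi> (s, z) * indicator ({0..1} \<times> UNIV) (s, z) \<partial>lborel \<partial>lborel) = (\<integral>\<^sup>+p. \<phi> p * indicator ({0..1} \<times> UNIV) p \<partial>lborel)"
  proof -
    have "(\<lambda>p. \<phi> p * indicator ({0..1} \<times> UNIV) p) \<in> borel_measurable lborel" by measurable
    then show ?thesis unfolding lborel_prod[symmetric] by (rule lborel_pair.nn_integral_snd)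
  qed
  finally show ?thesis .
qed

section \<open>From the profile to the area variable\<close>

lemma AE_lborel_fst: "AE x in lborel. P x \<Longrightarrow> AE p in lborel. P (fst (p :: real \<times> real))"
  and AE_lborel_snd: "AE x in lborel. P x \<Longrightarrow> AE p in lborel. P (snd (p :: real \<times> real))"
proof -
  assume ae: "AE x in lborel. P x"
  obtain N where N: "\<And>x. x \<notin> N \<Longrightarrow> P x" "N \<in> null_sets lborel"
    by (rule AE_E3[OF ae]) (rule that, simp_all)
  then have "emeasure (lborel \<Otimes>\<^sub>M lborel) (N \<times> UNIV) = 0" "emeasure (lborel \<Otimes>\<^sub>M lborel) (UNIV \<times> N) = 0"
    by (auto simp: lborel.emeasure_pair_measure_Times null_sets_def)
  then have "N \<times> UNIV \<in> null_sets (lborel :: (real \<times> real) measure)" "UNIV \<times> N \<in> null_sets (lborel :: (real \<times> real) measure)"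
    using N(2) by (auto simp: lborel_prod null_sets_def borel_Times)
  note null = this
  show "AE p in lborel. P (fst (p :: real \<times> real))"
    by (rule AE_I'[OF null(1)]) (clarsimp, rule ccontr, simp add: N(1))
  show "AE p in lborel. P (snd (p :: real \<times> real))"
    by (rule AE_I'[OF null(2)]) (clarsimp, rule ccontr, simp add: N(1))
qed

lemma AE_lborel_slices:
  fixes P :: "real \<times> real \<Rightarrow> bool"
  assumes "AE p in lborel. P p"
  shows "AE z in lborel. AE r in lborel. P (r, z)"
proof -
  obtain N where N: "\<And>x. x \<notin> N \<Longrightarrow> P x" "N \<in> null_sets lborel"
    by (rule AE_E3[OF assms]) (rule that, simp_all)
  then have "N \<in> sets lborel" "emeasure lborel N = 0" by auto
  then have N': "N \<in> sets (lborel \<Otimes>\<^sub>M lborel)" "emeasure (lborel \<Otimes>\<^sub>M lborel) N = 0"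
    by (simp_all only: lborel_prod)
  have "AE z in lborel. emeasure lborel ((\<lambda>r. (r, z)) -` N) = 0"
    using N' lborel_pair.measurable_emeasure_Pair2[OF N'(1)]
    by (subst nn_integral_0_iff_AE[symmetric]) (auto simp: lborel_pair.emeasure_pair_measure_alt2)
  then show ?thesis
  proof eventually_elim
    case (elim z)
    have "(\<lambda>r. (r, z)) -` N \<in> sets lborel" using sets_Pair2[OF N'(1)] by simp
    with elim have "(\<lambda>r. (r, z)) -` N \<in> null_sets lborel" by (simp add: null_sets_def)
    then show ?case by (rule AE_I') (clarsimp, rule ccontr, simp add: N(1))
  qed
qed

text \<open>Passes from a nonnegative integral over a Borel representative to the norms of a function that
  is only Lebesgue measurable.\<close>

lemma L2_of_AE_eq_borel:
  fixes f w :: "'a::euclidean_space \<Rightarrow> real"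
  assumes S: "S \<in> sets borel" and w[measurable]: "w \<in> borel_measurable borel"
    and ae: "AE p in lborel. p \<in> S \<longrightarrow> f p = w p"
    and int: "(\<integral>\<^sup>+p. ennreal ((w p)\<^sup>2) * indicator S p \<partial>lborel) = ennreal c" "0 \<le> c"
  shows "L2_on S f" "L2_norm S f = sqrt c"
proof -
  have S': "S \<in> sets lebesgue" using S by simp
  have aeL: "AE p in lebesgue_on S. f p = w p"
    using AE_completion[OF ae] S' by (simp add: AE_restrict_space_iff)
  have "(\<lambda>p. indicator S p *\<^sub>R w p) \<in> borel_measurable lebesgue"
    using S by (intro measurable_completion) auto
  moreover have "AE p in lebesgue. indicator S p *\<^sub>R w p = (if p \<in> S then f p else 0)"
    using AE_completion[OF ae] by eventually_elim auto
  ultimately have "(\<lambda>p. if p \<in> S then f p else 0) \<in> borel_measurable lebesgue"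
    by (rule borel_measurable_AE)
  then have f[measurable]: "f \<in> borel_measurable (lebesgue_on S)"
    using borel_measurable_if[OF S'] by blast
  have "(\<integral>\<^sup>+p. ennreal (\<bar>f p\<bar>\<^sup>2) \<partial>lebesgue_on S) = (\<integral>\<^sup>+p. ennreal ((w p)\<^sup>2) \<partial>lebesgue_on S)"
    using aeL by (intro nn_integral_cong_AE) (auto elim: eventually_mono)
  also have "\<dots> = (\<integral>\<^sup>+p. ennreal ((w p)\<^sup>2) * indicator S p \<partial>lborel)"
    using S' by (simp add: nn_integral_restrict_space nn_integral_completion)
  finally have nn: "(\<integral>\<^sup>+p. ennreal (\<bar>f p\<bar>\<^sup>2) \<partial>lebesgue_on S) = ennreal c"
    using int by simp
  have m: "(\<lambda>p. \<bar>f p\<bar>\<^sup>2) \<in> borel_measurable (lebesgue_on S)" by measurable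
  have "integrable (lebesgue_on S) (\<lambda>p. \<bar>f p\<bar>\<^sup>2)"
    by (rule integrableI_nn_integral_finite[OF m _ nn]) auto
  then show "L2_on S f" unfolding L2_on_def using f by simp
  have "(\<integral>p. \<bar>f p\<bar>\<^sup>2 \<partial>lebesgue_on S) = c"
    using m int(2) by (subst integral_eq_nn_integral) (auto simp only: nn, auto)
  then show "L2_norm S f = sqrt c" unfolding L2_norm_def by simp
qed

text \<open>Every point of the compact edge \<open>r = 1\<close> has a neighbourhood on which \<open>g\<close> vanishes almost
  everywhere; finitely many of them cover a strip along the edge.\<close>

lemma vanishing_near_lateral_boundary:
  assumes supp: "ess_support Omega g \<subseteq> {0..<1} \<times> {-1..1}"
  obtains \<eta> :: real where "0 < \<eta>" "\<eta> < 1/4"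
    "AE p in lebesgue. p \<in> Omega \<longrightarrow> 1 - 2 * \<eta> \<le> fst p \<longrightarrow> g p = 0"
proof -
  have "\<forall>z\<in>{-1..1}. \<exists>V. open V \<and> (1, z) \<in> V \<and> (AE q in lebesgue_on Omega. q \<in> V \<longrightarrow> g q = 0)"
  proof
    fix z :: real assume that: "z \<in> {-1..1}"
    have "(1, z) \<notin> ess_support Omega g" using supp by auto
    then show "\<exists>V. open V \<and> (1, z) \<in> V \<and> (AE q in lebesgue_on Omega. q \<in> V \<longrightarrow> g q = 0)"
      using that unfolding ess_support_def by (auto simp: Omega_def)
  qed
  from bchoice[OF this] obtain V where V: "\<And>z. z \<in> {-1..1} \<Longrightarrow> open (V z)" "\<And>z. z \<in> {-1..1} \<Longrightarrow> (1, z) \<in> V z"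
     "\<And>z. z \<in> {-1..1} \<Longrightarrow> AE q in lebesgue_on Omega. q \<in> V z \<longrightarrow> g q = 0"
    by blast
  have K: "compact ({1::real} \<times> {-1..1::real})" by (intro compact_Times) auto
  have cover: "{1::real} \<times> {-1..1::real} \<subseteq> (\<Union>z\<in>{-1..1}. V z)" using V(2) by auto
  obtain D where D: "D \<subseteq> {-1..1}" "finite D" "{1} \<times> {-1..1} \<subseteq> (\<Union>z\<in>D. V z)"
    by (rule compactE_image[OF K _ cover]) (rule V(1), assumption, rule that)
  have "open (\<Union>z\<in>D. V z)" using D(1) V(1) by (intro open_UN ballI) auto
  from compact_subset_open_imp_ball_epsilon_subset[OF K this D(3)] obtain e where
    e: "0 < e" "(\<Union>x\<in>{1} \<times> {-1..1}. ball x e) \<subseteq> (\<Union>z\<in>D. V z)" by blast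
  have "AE q in lebesgue_on Omega. \<forall>z\<in>D. q \<in> V z \<longrightarrow> g q = 0"
    using D V(3) by (subst AE_finite_all) auto
  then have ae: "AE q in lebesgue. q \<in> Omega \<longrightarrow> (\<forall>z\<in>D. q \<in> V z \<longrightarrow> g q = 0)"
    by (subst (asm) AE_restrict_space_iff) (auto simp: Omega_def intro!: sets_completionI_sets borel_closed closed_Times)
  \<comment> \<open>A quarter of \<open>e\<close> leaves room for a cut-off between \<open>1 - 2 * \<eta>\<close> and \<open>1 - \<eta>\<close>.\<close>
  define \<eta> where "\<eta> = min e (1/2) / 4"
  have \<eta>: "0 < \<eta>" "\<eta> < 1/4" "2 * \<eta> < e" using e(1) by (auto simp: \<eta>_def)
  show thesis
  proof (rule that[OF \<eta>(1,2)])
    show "AE p in lebesgue. p \<in> Omega \<longrightarrow> 1 - 2 * \<eta> \<le> fst p \<longrightarrow> g p = 0"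
      using ae
    proof (eventually_elim, intro impI)
      fix p assume p: "p \<in> Omega \<longrightarrow> (\<forall>z\<in>D. p \<in> V z \<longrightarrow> g p = 0)" "p \<in> Omega" "1 - 2 * \<eta> \<le> fst p"
      obtain r z where rz: "p = (r, z)" by (cases p)
      have "dist (1, z) p < e"
        using p \<eta> by (auto simp: rz Omega_def dist_Pair_Pair dist_real_def)
      then have "p \<in> (\<Union>x\<in>{1} \<times> {-1..1}. ball x e)"
        using p(2) by (auto simp: rz Omega_def)
      with e(2) p show "g p = 0" by blast
    qed
  qed
qed

text \<open>A scalar \<open>C\<^sup>1\<close> function supported in a box inside the open rectangle, placed in the radial
  component and normalised, is a competitor in the definition of the total variation.\<close>

lemma radial_test_field:
  assumes \<Phi>: "C1_partials \<Phi> \<Phi>r \<Phi>z" and K: "0 < K"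
    and box: "0 < a" "b < 1" "0 < c" "\<And>r z. r \<notin> {a..b} \<or> z \<notin> {-1+c..1-c} \<Longrightarrow> \<Phi> (r, z) = 0"
    and bd: "\<And>p. p \<in> Omega \<Longrightarrow> \<bar>\<Phi> p\<bar> \<le> K"
  defines "\<phi> \<equiv> \<lambda>p. (\<Phi> p / K, 0::real)"
  shows "\<phi> \<in> C1_compact_support ({0<..<1} \<times> {-1<..<1})" "Linf_enorm Omega \<phi> \<le> 1"
    "divergence \<phi> p = \<Phi>r p / K"
proof -
  have d: "(\<phi> has_derivative (\<lambda>h. ((fst h * \<Phi>r p + snd h * \<Phi>z p) / K, 0))) (at p)" for p
    unfolding \<phi>_def
    by (intro has_derivative_Pair has_derivative_const
        bounded_linear.has_derivative[OF bounded_linear_divide C1_partials_has_derivative[OF \<Phi>]])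
  define A B :: "(real \<times> real) \<Rightarrow>\<^sub>L (real \<times> real)" where "A = Blinfun (\<lambda>h. (fst h, 0))" and "B = Blinfun (\<lambda>h. (snd h, 0))"
  have bl: "bounded_linear (\<lambda>h :: real \<times> real. (fst h, 0 :: real))" "bounded_linear (\<lambda>h :: real \<times> real. (snd h, 0 :: real))"
    by (intro bounded_linear_Pair bounded_linear_fst bounded_linear_snd bounded_linear_zero)+
  define \<phi>' where "\<phi>' p = (\<Phi>r p / K) *\<^sub>R A + (\<Phi>z p / K) *\<^sub>R B" for p
  have ap: "blinfun_apply (\<phi>' p) = (\<lambda>h. ((fst h * \<Phi>r p + snd h * \<Phi>z p) / K, 0))" for p
    unfolding \<phi>'_def A_def B_def
    by (auto simp: blinfun.add_left blinfun.scaleR_left bounded_linear_Blinfun_apply[OF bl(1)]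
        bounded_linear_Blinfun_apply[OF bl(2)] add_divide_distrib mult.commute)
  have "continuous_on UNIV \<phi>'"
    unfolding \<phi>'_def[abs_def] using K
    by (intro continuous_intros C1_partials_continuous_partials[OF \<Phi>]) auto
  moreover have "(\<phi> has_derivative blinfun_apply (\<phi>' p)) (at p)" for p
    unfolding ap by (rule d)
  moreover have cl: "closure {p. \<phi> p \<noteq> 0} \<subseteq> {a..b} \<times> {-1+c..1-c}"
  proof (rule closure_minimal)
    show "{p. \<phi> p \<noteq> 0} \<subseteq> {a..b} \<times> {-1+c..1-c}"
      using box(4) by (force simp: \<phi>_def zero_prod_def)
  qed (intro closed_Times closed_atLeastAtMost)
  moreover have "bounded {p. \<phi> p \<noteq> 0}"
  proof (rule bounded_subset)
    show "{p. \<phi> p \<noteq> 0} \<subseteq> {a..b} \<times> {-1+c..1-c}" using cl closure_subset by (rule order_trans[rotated])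
    show "bounded ({a..b} \<times> {-1+c..1-c})" by (intro bounded_Times) auto
  qed
  then have "compact (closure {p. \<phi> p \<noteq> 0})" by (simp only: compact_closure)
  moreover have "{a..b} \<times> {-1+c..1-c} \<subseteq> {0<..<1} \<times> {-1<..<1}" using box by auto
  ultimately show "\<phi> \<in> C1_compact_support ({0<..<1} \<times> {-1<..<1})"
    unfolding C1_compact_support_def mem_Collect_eq
    by (intro conjI exI[of _ \<phi>'] allI) (assumption | erule (1) order_trans)+
  have "continuous_on UNIV \<phi>" using has_derivative_continuous_on[OF has_derivative_at_withinI[OF d]] .
  then have "(\<lambda>p. norm (\<phi> p)) \<in> borel_measurable borel"
    by (intro borel_measurable_continuous_onI continuous_on_norm)
  then have m: "(\<lambda>p. ereal (norm (\<phi> p))) \<in> borel_measurable (lebesgue_on Omega)"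
    by (intro measurable_restrict_space1 measurable_completion) simp
  show "Linf_enorm Omega \<phi> \<le> 1"
    unfolding Linf_enorm_def
  proof (rule esssup_I[OF m])
    show "AE p in lebesgue_on Omega. ereal (norm (\<phi> p)) \<le> 1"
    proof (rule AE_I2)
      fix p assume "p \<in> space (lebesgue_on Omega)"
      then have "\<bar>\<Phi> p\<bar> \<le> K" using bd by simp
      then show "ereal (norm (\<phi> p)) \<le> 1" using K by (simp add: \<phi>_def norm_prod_def)
    qed
  qed
  show "divergence \<phi> p = \<Phi>r p / K"
    unfolding divergence_def frechet_derivative_at[OF d, symmetric] by simp
qed

text \<open>A Borel function \<open>g0\<close> that represents the profile \<open>g\<close> almost everywhere, is bounded everywhere by
  the essential supremum, and is set to 0 near the lateral boundary and on the null set formed by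
  the axis and the two ends.\<close>

locale profile_representative =
  fixes g g0 :: "real \<times> real \<Rightarrow> real" and M \<eta> :: real
  assumes g0_measurable [measurable]: "g0 \<in> borel_measurable borel"
    and g0_bounded: "\<And>p. \<bar>g0 p\<bar> \<le> M"
    and g0_support: "\<And>r z. \<not> (0 < r \<and> r < 1 - 2 * \<eta> \<and> \<bar>z\<bar> < 1) \<Longrightarrow> g0 (r, z) = 0"
    and \<eta>: "0 < \<eta>" "\<eta> < 1/4"
    and g_AE: "AE p in lborel. g p = g0 p"
begin

definition v :: "real \<times> real \<Rightarrow> real" where
  "v p = g0 (sqrt (fst p), snd p)"

lemma v_measurable [measurable]: "v \<in> borel_measurable borel"
  unfolding v_def[abs_def] borel_prod[symmetric] by measurable

lemma v_bounded: "\<bar>v p\<bar> \<le> M"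
  unfolding v_def by (rule g0_bounded)

lemma v_support: "p \<notin> {0<..<1} \<times> {-1<..<1} \<Longrightarrow> v p = 0"
proof -
  assume p: "p \<notin> {0<..<1} \<times> {-1<..<1}"
  have "fst p < 1" if "sqrt (fst p) < 1 - 2 * \<eta>"
  proof -
    have "sqrt (fst p) < 1" using that \<eta> by linarith
    then show ?thesis by (simp add: real_sqrt_lt_1_iff)
  qed
  then show ?thesis
    using p unfolding v_def by (intro g0_support) (cases p, auto simp: abs_less_iff)
qed

lemma v_square: "0 \<le> r \<Longrightarrow> v (r\<^sup>2, z) = g0 (r, z)"
  by (simp add: v_def)

lemma weighted_integral_eq:
  assumes f[measurable]: "f \<in> borel_measurable borel"
  shows "(\<integral>p. g0 p * (2 * fst p * f (area_map p)) \<partial>lborel) = (\<integral>p. v p * f p \<partial>lborel)"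
proof -
  have "(\<integral>p. v p * f p \<partial>lborel) = (\<integral>p. indicator ({0..1} \<times> UNIV) p * (v p * f p) \<partial>lborel)"
  proof (intro Bochner_Integration.integral_cong refl)
    show "v p * f p = indicator ({0..1} \<times> UNIV) p * (v p * f p)" for p
      using v_support[of p] by (cases "p \<in> {0<..<1} \<times> {-1<..<1}") auto
  qed
  also have "\<dots> = (\<integral>p. indicator ({0..1} \<times> UNIV) p * (2 * fst p * (v (area_map p) * f (area_map p))) \<partial>lborel)"
    by (rule integral_area_map) measurable
  also have "\<dots> = (\<integral>p. g0 p * (2 * fst p * f (area_map p)) \<partial>lborel)"
  proof (intro Bochner_Integration.integral_cong refl)
    fix p :: "real \<times> real"
    obtain r z where p: "p = (r, z)" by (cases p)
    show "indicator ({0..1} \<times> UNIV) p * (2 * fst p * (v (area_map p) * f (area_map p))) = g0 p * (2 * fst p * f (area_map p))"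
      using g0_support[of r z] \<eta> v_square[of r z] by (cases "0 \<le> r \<and> r \<le> 1") (auto simp: p area_map_def)
  qed
  finally show ?thesis by simp
qed

text \<open>A test function \<open>\<psi> (s, z)\<close> is pulled back to \<open>\<psi> (r\<^sup>2, z)\<close>, whose radial derivative carries the
  factor \<open>2 r\<close> of the substitution, so the variation is the same in both variables. The cut-off
  near \<open>r = 1\<close> makes the support compact; it is constant on the set where \<open>g0\<close> is nonzero. The
  pull-back uses the positive part of \<open>r\<close>, because \<open>\<psi> (r\<^sup>2, z)\<close> would also be supported at
  negative \<open>r\<close>.\<close>

lemma radial_variation_le_TV:
  assumes T: "TV_enorm g = ereal T"
  shows "radial_variation_le v T"
  unfolding radial_variation_le_def
proof (intro allI impI)
  fix \<psi> \<psi>s \<psi>z :: "real \<times> real \<Rightarrow> real" and \<epsilon> K :: real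
  assume \<psi>: "C1_partials \<psi> \<psi>s \<psi>z" and \<epsilon>: "0 < \<epsilon>" "clear_of_axis_and_ends \<epsilon> \<psi>"
    and K: "0 < K" and bd: "\<forall>p\<in>Omega. \<bar>\<psi> p\<bar> \<le> K"
  define q :: "real \<Rightarrow> real" where "q r = (max 0 r)\<^sup>2" for r
  define \<Phi> where "\<Phi> p = \<psi> (q (fst p), snd p) * smooth_step ((- 1 / \<eta>) * fst p + (1 - \<eta>) / \<eta>)" for p
  define \<Phi>r where "\<Phi>r p = (2 * max 0 (fst p) * \<psi>s (q (fst p), snd p)) * smooth_step ((- 1 / \<eta>) * fst p + (1 - \<eta>) / \<eta>)
      + \<psi> (q (fst p), snd p) * ((- 1 / \<eta>) * smooth_step' ((- 1 / \<eta>) * fst p + (1 - \<eta>) / \<eta>))" for p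
  have "C1_partials (\<lambda>p. \<psi> (q (fst p), snd p)) (\<lambda>p. 2 * max 0 (fst p) * \<psi>s (q (fst p), snd p)) (\<lambda>p. \<psi>z (q (fst p), snd p))"
    unfolding q_def
    by (rule C1_partials_reparam_fst[OF \<psi> has_real_derivative_positive_part_squared]) (intro continuous_intros)
  from C1_partials_mult[OF this C1_partials_smooth_step_affine(1)[of "- 1 / \<eta>" "(1 - \<eta>) / \<eta>"]]
  obtain \<Phi>z where \<Phi>: "C1_partials \<Phi> \<Phi>r \<Phi>z"
    unfolding \<Phi>_def[abs_def] \<Phi>r_def[abs_def] by blast
  have zero: "\<Phi> (r, z) = 0" if rz: "r \<notin> {sqrt \<epsilon>..1 - \<eta>} \<or> z \<notin> {-1 + \<epsilon>..1 - \<epsilon>}" for r z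
  proof -
    consider "r < sqrt \<epsilon>" | "1 - \<eta> < r" | "1 - \<epsilon> \<le> \<bar>z\<bar>"
    proof -
      have "r < sqrt \<epsilon> \<or> 1 - \<eta> < r \<or> 1 - \<epsilon> \<le> \<bar>z\<bar>" using rz by (auto simp: abs_if)
      then show ?thesis using that by blast
    qed
    then show ?thesis
    proof cases
      case 1
      have "(max 0 r)\<^sup>2 \<le> (sqrt \<epsilon>)\<^sup>2" using 1 \<epsilon>(1) by (intro power_mono) auto
      then have "q r \<le> \<epsilon>" using \<epsilon>(1) by (simp add: q_def)
      then show ?thesis using \<epsilon>(2) by (simp add: \<Phi>_def clear_of_axis_and_ends_def)
    next
      case 2
      then have "(1 - \<eta> - r) / \<eta> \<le> 0" using \<eta>(1) by (intro divide_nonpos_pos) auto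
      then have "(- 1 / \<eta>) * r + (1 - \<eta>) / \<eta> \<le> 0" by (simp add: diff_divide_distrib)
      then show ?thesis by (simp add: \<Phi>_def smooth_step_le_0)
    next
      case 3
      then show ?thesis using \<epsilon>(2) by (simp add: \<Phi>_def clear_of_axis_and_ends_def)
    qed
  qed
  have bound: "\<bar>\<Phi> p\<bar> \<le> K" if p: "p \<in> Omega" for p
  proof -
    have "(max 0 (fst p))\<^sup>2 \<le> 1" using p by (intro power_le_one) (auto simp: Omega_def)
    then have "(q (fst p), snd p) \<in> Omega" using p by (auto simp: Omega_def q_def)
    then have "\<bar>\<psi> (q (fst p), snd p)\<bar> \<le> K" using bd by blast
    then have "\<bar>\<Phi> p\<bar> \<le> K * 1"
      unfolding \<Phi>_def abs_mult using K smooth_step_bounds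
      by (intro mult_mono) auto
    then show ?thesis by simp
  qed
  define \<phi> where "\<phi> = (\<lambda>p. (\<Phi> p / K, 0::real))"
  have "0 < sqrt \<epsilon>" "1 - \<eta> < 1" using \<epsilon>(1) \<eta>(1) by auto
  note field = radial_test_field[OF \<Phi> K this \<epsilon>(1) zero bound, folded \<phi>_def]
  have div: "divergence \<phi> p = \<Phi>r p / K" for p by (rule field(3))
  have "ereal (\<integral>p. g p * divergence \<phi> p \<partial>lebesgue_on Omega) \<le> TV_enorm g"
    unfolding TV_enorm_def by (rule SUP_upper) (use field(1,2) in simp)
  then have le: "(\<integral>p. g p * divergence \<phi> p \<partial>lebesgue_on Omega) \<le> T" by (simp add: T)
  have c: "\<psi>s \<in> borel_measurable borel" "\<Phi>r \<in> borel_measurable borel"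
    using C1_partials_continuous_partials(1)[OF \<psi>, of UNIV] C1_partials_continuous_partials(1)[OF \<Phi>, of UNIV]
    by (auto intro: borel_measurable_continuous_onI)
  note [measurable] = c
  have OmB: "Omega \<in> sets borel" unfolding Omega_def by (intro borel_closed closed_Times) auto
  have [measurable]: "(fst :: real \<times> real \<Rightarrow> real) \<in> borel_measurable borel" unfolding borel_prod[symmetric] by measurable
  have eq: "indicator Omega p * (g0 p * (\<Phi>r p / K)) = g0 p * (2 * fst p * \<psi>s (area_map p)) / K" for p
  proof (cases "0 < fst p \<and> fst p < 1 - 2 * \<eta> \<and> \<bar>snd p\<bar> < 1")
    case True
    then have "1 \<le> (1 - \<eta> - fst p) / \<eta>" using \<eta>(1) by (simp add: le_divide_eq)
    then have 1: "1 \<le> (- 1 / \<eta>) * fst p + (1 - \<eta>) / \<eta>" by (simp add: diff_divide_distrib)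
    have "p \<in> Omega" using True \<eta> by (cases p) (auto simp: Omega_def)
    moreover have "\<Phi>r p = 2 * fst p * \<psi>s (area_map p)"
      unfolding \<Phi>r_def smooth_step_ge_1[OF 1] smooth_step'_ge_1[OF 1]
      using True by (simp add: q_def area_map_def)
    ultimately show ?thesis by simp
  next
    case False
    then have "g0 p = 0" using g0_support[of "fst p" "snd p"] by simp
    then show ?thesis by simp
  qed
  have "(\<integral>p. g p * divergence \<phi> p \<partial>lebesgue_on Omega) = (\<integral>p. indicator Omega p *\<^sub>R (g p * divergence \<phi> p) \<partial>lebesgue)"
    using OmB by (intro integral_restrict_space) auto
  also have "\<dots> = (\<integral>p. g0 p * (2 * fst p * \<psi>s (area_map p)) / K \<partial>lebesgue)"
  proof -
    have ae: "AE p in lebesgue. g0 p * (2 * fst p * \<psi>s (area_map p)) / K = indicator Omega p *\<^sub>R (g p * divergence \<phi> p)"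
      using AE_completion[OF g_AE] by eventually_elim (simp add: div eq[symmetric])
    have m: "(\<lambda>p. g0 p * (2 * fst p * \<psi>s (area_map p)) / K) \<in> borel_measurable lebesgue"
      by (intro measurable_completion) measurable
    show ?thesis
      using ae by (intro integral_cong_AE borel_measurable_AE[OF m ae] m) (auto elim: eventually_mono)
  qed
  also have "\<dots> = (\<integral>p. g0 p * (2 * fst p * \<psi>s (area_map p)) / K \<partial>lborel)"
    by (intro integral_completion) measurable
  also have "\<dots> = (\<integral>p. v p * \<psi>s p \<partial>lborel) / K"
    by (simp add: weighted_integral_eq)
  finally have "(\<integral>p. v p * \<psi>s p \<partial>lborel) / K \<le> T" using le by simp
  then show "(\<integral>p. v p * \<psi>s p \<partial>lborel) \<le> K * T"
    using K by (simp only: pos_divide_le_eq mult.commute)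
qed

lemma abel_eq_area_abel:
  assumes ae: "AE r in lborel. g (r, z) = g0 (r, z)" and x: "0 \<le> x"
  shows "abel g (x, z) = area_abel (\<lambda>s. v (s, z)) (x\<^sup>2)"
proof -
  let ?f = "\<lambda>r. indicator {x<..} r *\<^sub>R (g0 (r, z) * r / sqrt (r\<^sup>2 - x\<^sup>2))"
  have [measurable]: "(\<lambda>s. v (s, z)) \<in> borel_measurable borel" by measurable
  have m: "?f \<in> borel_measurable lborel" by measurable
  have m': "?f \<in> borel_measurable lebesgue" using m by (rule measurable_completion)
  have ae': "AE r in lebesgue. ?f r = indicator {x<..} r *\<^sub>R (g (r, z) * r / sqrt (r\<^sup>2 - x\<^sup>2))"
    using AE_completion[OF ae] by eventually_elim simp
  have "(LINT r:{x<..}|lebesgue. g (r, z) * r / sqrt (r\<^sup>2 - x\<^sup>2)) = (\<integral>r. ?f r \<partial>lebesgue)"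
    unfolding set_lebesgue_integral_def
    using ae' by (intro integral_cong_AE borel_measurable_AE[OF m' ae'] m') (auto elim: eventually_mono)
  also have "\<dots> = (\<integral>r. ?f r \<partial>lborel)" by (rule integral_completion[OF m])
  finally have "abel g (x, z) = 2 * (\<integral>r. ?f r \<partial>lborel)" by (simp add: abel_def)
  also have "\<dots> = (\<integral>r. 2 * ?f r \<partial>lborel)" by (rule integral_mult_right_zero[symmetric])
  also have "\<dots> = (\<integral>r. indicator {0..1} r * (2 * r * (indicator {x\<^sup>2<..} (r\<^sup>2) * (v (r\<^sup>2, z) / sqrt (r\<^sup>2 - x\<^sup>2)))) \<partial>lborel)"
  proof (intro Bochner_Integration.integral_cong refl)
    fix r :: real
    show "2 * ?f r = indicator {0..1} r * (2 * r * (indicator {x\<^sup>2<..} (r\<^sup>2) * (v (r\<^sup>2, z) / sqrt (r\<^sup>2 - x\<^sup>2))))"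
    proof (cases "0 \<le> r \<and> r \<le> 1")
      case True
      then have "x\<^sup>2 < r\<^sup>2 \<longleftrightarrow> x < r" using x by (auto simp: power_strict_mono intro: power_less_imp_less_base)
      then show ?thesis using True by (auto simp: indicator_def v_square)
    next
      case False
      then have "g0 (r, z) = 0" using \<eta> by (intro g0_support) auto
      then show ?thesis using False by (auto simp: indicator_def)
    qed
  qed
  also have "\<dots> = (\<integral>s. indicator {0..1} s * (indicator {x\<^sup>2<..} s * (v (s, z) / sqrt (s - x\<^sup>2))) \<partial>lborel)"
    by (rule integral_square_substitution[symmetric]) measurable
  also have "\<dots> = area_abel (\<lambda>s. v (s, z)) (x\<^sup>2)"
    unfolding area_abel_def
  proof (intro Bochner_Integration.integral_cong refl)
    show "indicator {0..1} s * (indicator {x\<^sup>2<..} s * (v (s, z) / sqrt (s - x\<^sup>2))) = indicator {x\<^sup>2<..} s * (v (s, z) / sqrt (s - x\<^sup>2))" for s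
      using v_support[of "(s, z)"] by (cases "s \<in> {0..1}") auto
  qed
  finally show ?thesis .
qed

lemma abel_AE: "AE p in lborel. p \<in> Omega \<longrightarrow> abel g p = area_abel (\<lambda>s. v (s, snd p)) ((fst p)\<^sup>2)"
  using AE_lborel_snd[OF AE_lborel_slices[OF g_AE]]
proof eventually_elim
  case (elim p)
  then show ?case
    using abel_eq_area_abel[of "snd p" "fst p"] by (cases p) (auto simp: Omega_def)
qed

text \<open>The profile agrees with its representative only outside a null set of the half-plane. Rotating
  such a set about the axis gives a null set in space, by the two changes of variables.\<close>

lemma axisymmetric_AE:
  assumes u: "axisymmetric u" "g = profile u"
  shows "AE p in lborel. p \<in> cylinder \<longrightarrow> u p = v ((fst p)\<^sup>2 + (fst (snd p))\<^sup>2, snd (snd p))"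
proof -
  obtain h where h: "\<And>x y z. (x, y, z) \<in> cylinder \<Longrightarrow> u (x, y, z) = h (sqrt (x\<^sup>2 + y\<^sup>2), z)"
    using u(1) unfolding axisymmetric_def by fast
  have fst1: "AE p in lborel. fst (p :: real \<times> real) \<noteq> 1"
    by (rule AE_lborel_fst[OF AE_lborel_singleton])
  have "AE p in lborel. g p = g0 p \<and> fst p \<noteq> 1" using g_AE fst1 by eventually_elim simp
  then obtain N where N: "\<And>p. p \<notin> N \<Longrightarrow> g p = g0 p \<and> fst p \<noteq> 1" "N \<in> null_sets lborel"
    by (rule AE_E3) (rule that, simp_all)
  have [measurable]: "N \<in> sets borel" using N(2) by auto
  have [measurable]: "(fst :: real \<times> real \<Rightarrow> real) \<in> borel_measurable borel" unfolding borel_prod[symmetric] by measurable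
  \<comment> \<open>The indicator of \<open>N\<close>, read in the area variable.\<close>
  define \<chi>N :: "real \<times> real \<Rightarrow> ennreal" where "\<chi>N = (\<lambda>p. indicator N (sqrt (fst p), snd p))"
  have \<chi>m[measurable]: "\<chi>N \<in> borel_measurable borel"
  proof -
    have "(\<lambda>p::real\<times>real. (sqrt (fst p), snd p)) \<in> borel_measurable borel"
      unfolding borel_prod[symmetric] by measurable
    then show ?thesis unfolding \<chi>N_def by measurable
  qed
  let ?k = "\<lambda>p :: real \<times> real \<times> real. \<chi>N ((fst p)\<^sup>2 + (fst (snd p))\<^sup>2, snd (snd p)) * indicator {..1} ((fst p)\<^sup>2 + (fst (snd p))\<^sup>2)"
  have "?k \<in> borel_measurable (borel \<Otimes>\<^sub>M borel \<Otimes>\<^sub>M borel)" by measurable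
  then have km: "?k \<in> borel_measurable lborel" by (simp add: borel_prod)
  have "(\<integral>\<^sup>+p. ?k p \<partial>lborel) = ennreal pi * (\<integral>\<^sup>+p. \<chi>N p * indicator ({0..1} \<times> UNIV) p \<partial>lborel)"
    by (rule nn_integral_cylinder[OF \<chi>m])
  also have "(\<integral>\<^sup>+p. \<chi>N p * indicator ({0..1} \<times> UNIV) p \<partial>lborel)
      = (\<integral>\<^sup>+p. \<chi>N (area_map p) * ennreal (2 * fst p) * indicator ({0..1} \<times> UNIV) p \<partial>lborel)"
    by (rule nn_integral_area_map[OF \<chi>m])
  also have "\<dots> = (\<integral>\<^sup>+p. 0 \<partial>(lborel :: (real \<times> real) measure))"
  proof (rule nn_integral_cong_AE)
    have "AE p in lborel. p \<notin> N" using N(2) by (rule AE_not_in)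
    then show "AE p in lborel. \<chi>N (area_map p) * ennreal (2 * fst p) * indicator ({0..1} \<times> UNIV) p = 0"
    proof eventually_elim
      case (elim p)
      then show ?case by (cases p) (auto simp: \<chi>N_def area_map_def indicator_def)
    qed
  qed
  finally have "(\<integral>\<^sup>+p. ?k p \<partial>lborel) = 0" by simp
  then have "AE p in lborel. ?k p = 0" using km by (simp only: nn_integral_0_iff_AE)
  then show ?thesis
  proof (eventually_elim, intro impI)
    fix p :: "real \<times> real \<times> real"
    assume k: "?k p = 0" and p: "p \<in> cylinder"
    obtain x y z where xyz: "p = (x, y, z)" by (cases p)
    define r where "r = sqrt (x\<^sup>2 + y\<^sup>2)"
    have cyl: "x\<^sup>2 + y\<^sup>2 \<le> 1" "z \<in> {-1..1}" using p by (auto simp: xyz cylinder_def)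
    then have "(r, z) \<notin> N" using k by (auto simp: xyz \<chi>N_def r_def indicator_def split: if_splits)
    then have g: "g (r, z) = g0 (r, z)" "r \<noteq> 1" using N(1)[of "(r, z)"] by auto
    have r: "0 \<le> r" "r < 1" using cyl g(2) by (auto simp: r_def real_sqrt_le_1_iff less_le)
    have "(r, 0, z) \<in> cylinder" using cyl by (auto simp: cylinder_def r_def)
    from h[OF this] have "u (r, 0, z) = h (r, z)" using r by simp
    moreover have "u p = h (r, z)" using h p by (simp add: xyz r_def)
    moreover have "g (r, z) = u (r, 0, z)" using r cyl by (simp add: u(2) profile_def)
    ultimately have "u p = g0 (r, z)" using g by simp
    then show "u p = v ((fst p)\<^sup>2 + (fst (snd p))\<^sup>2, snd (snd p))" by (simp add: xyz v_def r_def)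
  qed
qed

end

text \<open>The representative is a Borel version of \<open>g\<close>, truncated at the essential bound and multiplied
  by the indicator of an open rectangle outside which \<open>g\<close> vanishes almost everywhere.\<close>

lemma exists_profile_representative:
  assumes Linf: "Linf_on Omega g" and supp: "ess_support Omega g \<subseteq> {0..<1} \<times> {-1..1}"
    and out: "\<And>p. p \<notin> Omega \<Longrightarrow> g p = 0"
  obtains g0 \<eta> where "profile_representative g g0 (Linf_norm Omega g) \<eta>"
proof -
  let ?M = "Linf_norm Omega g"
  have Om: "Omega \<in> sets borel" unfolding Omega_def by (intro borel_closed closed_Times) auto
  then have OmL: "Omega \<in> sets lebesgue" by simp
  have gm: "g \<in> borel_measurable (lebesgue_on Omega)" and fin: "Linf_enorm Omega g < \<infinity>"
    using Linf by (auto simp: Linf_on_def)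
  have ess: "AE p in lebesgue_on Omega. ereal (norm (g p)) \<le> Linf_enorm Omega g"
    unfolding Linf_enorm_def by (rule esssup_AE)
  have pos: "emeasure (lebesgue_on Omega) (space (lebesgue_on Omega)) \<noteq> 0"
  proof -
    have "emeasure lborel ({0..1::real} \<times> {-1..1::real}) = 2"
      by (subst lborel_prod[symmetric], subst lborel.emeasure_pair_measure_Times) auto
    then show ?thesis using OmL Om by (simp add: emeasure_restrict_space Omega_def)
  qed
  have "0 \<le> Linf_enorm Omega g"
  proof -
    have "0 = esssup (lebesgue_on Omega) (\<lambda>p. 0 :: ereal)" using esssup_const[OF pos] by simp
    also have "\<dots> \<le> Linf_enorm Omega g"
      unfolding Linf_enorm_def by (rule esssup_mono) auto
    finally show ?thesis .
  qed
  with fin have M: "Linf_enorm Omega g = ereal ?M" "0 \<le> ?M"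
    unfolding Linf_norm_def by (cases "Linf_enorm Omega g"; simp)+
  obtain \<eta> where \<eta>: "0 < \<eta>" "\<eta> < 1/4" and van: "AE p in lebesgue. p \<in> Omega \<longrightarrow> 1 - 2 * \<eta> \<le> fst p \<longrightarrow> g p = 0"
    using vanishing_near_lateral_boundary[OF supp] .
  have "(\<lambda>p. if p \<in> Omega then g p else 0) = g" using out by auto
  then have "g \<in> borel_measurable lebesgue" using borel_measurable_if[OF OmL, of g] gm by simp
  from completion_ex_borel_measurable_real[OF this]
  obtain g1 where g1: "g1 \<in> borel_measurable lborel" "AE p in lborel. g p = g1 p" by blast
  have [measurable]: "g1 \<in> borel_measurable borel" using g1(1) by simp
  define g0 where "g0 = (\<lambda>p. if 0 < fst p \<and> fst p < 1 - 2 * \<eta> \<and> \<bar>snd p\<bar> < 1 then max (- ?M) (min ?M (g1 p)) else 0)"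
  have "AE p in lebesgue. p \<in> Omega \<longrightarrow> \<bar>g p\<bar> \<le> ?M"
    using ess OmL by (simp add: AE_restrict_space_iff M(1))
  then have b: "AE p in lborel. p \<in> Omega \<longrightarrow> \<bar>g p\<bar> \<le> ?M"
    by (simp only: AE_completion_iff)
  have v: "AE p in lborel. p \<in> Omega \<longrightarrow> 1 - 2 * \<eta> \<le> fst p \<longrightarrow> g p = 0"
    using van by (simp only: AE_completion_iff)
  have "AE p in lborel. g p = g0 p"
    using b v g1(2) AE_lborel_fst[OF AE_lborel_singleton[of 0]]
      AE_lborel_snd[OF AE_lborel_singleton[of 1]] AE_lborel_snd[OF AE_lborel_singleton[of "-1"]]
  proof eventually_elim
    case (elim p)
    show ?case
    proof (cases "0 < fst p \<and> fst p < 1 - 2 * \<eta> \<and> \<bar>snd p\<bar> < 1")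
      case True
      then have "p \<in> Omega" using \<eta> by (cases p) (auto simp: Omega_def)
      then show ?thesis using True elim by (auto simp: g0_def)
    next
      case False
      have "p \<in> Omega \<Longrightarrow> 1 - 2 * \<eta> \<le> fst p"
        using False elim(4-6) by (cases p) (auto simp: Omega_def abs_if split: if_splits)
      then have "g p = 0" using elim(2) out[of p] by blast
      moreover have "g0 p = 0" unfolding g0_def using False by (rule if_not_P)
      ultimately show ?thesis by simp
    qed
  qed
  moreover have "g0 \<in> borel_measurable borel"
  proof -
    have [measurable]: "g1 \<in> borel_measurable (borel \<Otimes>\<^sub>M borel)" by (simp add: borel_prod)
    have "g0 \<in> borel_measurable (borel \<Otimes>\<^sub>M borel)" unfolding g0_def by measurable
    then show ?thesis by (simp add: borel_prod)
  qed
  ultimately have "profile_representative g g0 ?M \<eta>"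
    using M(2) \<eta> by unfold_locales (auto simp: g0_def)
  then show thesis by (rule that)
qed

section \<open>The estimate\<close>

lemma radial_variation_le_nonneg:
  assumes "radial_variation_le v T"
  shows "0 \<le> T"
proof -
  have "(\<integral>p. v p * 0 \<partial>lborel) \<le> 1 * T"
    by (rule assms[unfolded radial_variation_le_def, rule_format, of "\<lambda>_. 0" "\<lambda>_. 0" "\<lambda>_. 0" 1])
      (use C1_partials_const[of 0] in \<open>auto simp: clear_of_axis_and_ends_def\<close>)
  then show ?thesis by simp
qed

theorem theorem3p18:
  shows "\<exists>C::real. \<forall>(u :: real \<times> real \<times> real \<Rightarrow> real) (f :: real \<times> real \<Rightarrow> real).
    axisymmetric u \<longrightarrow>
    BV_Omega (profile u) \<longrightarrow>
    Linf_on Omega (profile u) \<longrightarrow>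
    ess_support Omega (profile u) \<subseteq> {0..<1} \<times> {-1..1} \<longrightarrow>
    (AE p in lebesgue_on Omega. abel (profile u) p = f p) \<longrightarrow>
      L2_on cylinder u \<and> L2_on Omega f \<and>
      L2_norm cylinder u \<le>
        C * Linf_norm Omega (profile u) powr (1/3) * TV_norm (profile u) powr (1/3)
          * L2_norm Omega f powr (1/3)"
  (* 6 is a round number: the square of the constant must be at least 4 * pi times the cube root of 2. *)
proof (rule exI[of _ 6], intro allI impI)
  fix u :: "real \<times> real \<times> real \<Rightarrow> real" and f :: "real \<times> real \<Rightarrow> real"
  assume axi: "axisymmetric u" and BV: "BV_Omega (profile u)" and Linf: "Linf_on Omega (profile u)"
    and supp: "ess_support Omega (profile u) \<subseteq> {0..<1} \<times> {-1..1}"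
    and f: "AE p in lebesgue_on Omega. abel (profile u) p = f p"
  define g where "g = profile u"
  define M where "M = Linf_norm Omega g"
  define T where "T = TV_norm g"
  have out: "p \<notin> Omega \<Longrightarrow> g p = 0" for p
    by (cases p) (auto simp: g_def profile_def Omega_def)
  obtain g0 \<eta> where rep: "profile_representative g g0 M \<eta>"
    using exists_profile_representative[OF Linf supp] out unfolding M_def g_def by blast
  interpret profile_representative g g0 M \<eta> by (rule rep)
  have TV: "TV_enorm g = ereal T"
  proof -
    have "(\<lambda>_. 0) \<in> C1_compact_support ({0<..<1} \<times> {-1<..<1})"
      unfolding C1_compact_support_def by (auto intro!: exI[of _ "\<lambda>_. 0"] simp: zero_blinfun.rep_eq)
    moreover have "Linf_enorm Omega (\<lambda>_. 0 :: real \<times> real) \<le> 1"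
      unfolding Linf_enorm_def by (rule esssup_I) auto
    ultimately have "ereal (\<integral>p. g p * divergence (\<lambda>_. 0) p \<partial>lebesgue_on Omega) \<le> TV_enorm g"
      unfolding TV_enorm_def by (intro SUP_upper) simp
    moreover have "TV_enorm g < \<infinity>" using BV by (simp add: BV_Omega_def g_def)
    ultimately show ?thesis unfolding T_def TV_norm_def by (cases "TV_enorm g") auto
  qed
  note var = radial_variation_le_TV[OF TV]
  interpret bounded_area_profile v M T
    by unfold_locales (auto intro: v_bounded v_support radial_variation_le_nonneg[OF var] var)
  have F_eq: "area_abel (\<lambda>s. v (s, snd p)) ((fst p)\<^sup>2) = F (area_map p)" for p
    by (simp add: F_def area_map_def)
  let ?R = "{0<..<1::real} \<times> {-1<..<1::real}"
  have OmB[measurable]: "Omega \<in> sets borel" unfolding Omega_def by (intro borel_closed closed_Times) auto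
  have [measurable]: "(fst :: real \<times> real \<Rightarrow> real) \<in> borel_measurable borel"
     "(snd :: real \<times> real \<Rightarrow> real) \<in> borel_measurable borel" unfolding borel_prod[symmetric] by measurable

  define c where "c = (\<integral>p. indicator Omega p * (F (area_map p))\<^sup>2 \<partial>lborel)"
  have c_nn: "(\<integral>\<^sup>+p. ennreal ((F (area_map p))\<^sup>2) * indicator Omega p \<partial>lborel) = ennreal c"
  proof -
    have "integrable lborel (\<lambda>p. indicator Omega p * (F (area_map p))\<^sup>2)"
    proof (rule integrable_bounded_of_bounded_support[OF _ _ compact_Omega])
      fix p
      have "\<bar>F (area_map p)\<bar>\<^sup>2 \<le> (2 * M)\<^sup>2"
        unfolding area_map_def by (intro power_mono F_bounded) auto
      then show "\<bar>indicator Omega p * (F (area_map p))\<^sup>2\<bar> \<le> (2 * M)\<^sup>2" by (auto simp: indicator_def)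
    qed auto
    then have "(\<integral>\<^sup>+p. ennreal (indicator Omega p * (F (area_map p))\<^sup>2) \<partial>lborel) = ennreal c"
      unfolding c_def by (intro nn_integral_eq_integral) auto
    moreover have "(\<integral>\<^sup>+p. ennreal (indicator Omega p * (F (area_map p))\<^sup>2) \<partial>lborel)
        = (\<integral>\<^sup>+p. ennreal ((F (area_map p))\<^sup>2) * indicator Omega p \<partial>lborel)"
      by (intro nn_integral_cong) (auto simp: indicator_def)
    ultimately show ?thesis by simp
  qed
  have c0: "0 \<le> c" unfolding c_def by (intro Bochner_Integration.integral_nonneg) auto
  have "AE p in lebesgue. p \<in> Omega \<longrightarrow> abel g p = f p"
    using f OmB by (simp add: AE_restrict_space_iff g_def)
  then have "AE p in lborel. p \<in> Omega \<longrightarrow> abel g p = f p" by (simp only: AE_completion_iff)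
  then have f_AE: "AE p in lborel. p \<in> Omega \<longrightarrow> f p = F (area_map p)"
    using abel_AE by eventually_elim (simp add: F_eq)
  have f_L2: "L2_on Omega f" "L2_norm Omega f = sqrt c"
    by (rule L2_of_AE_eq_borel[OF OmB _ f_AE c_nn c0]; measurable)+

  have "(\<integral>\<^sup>+p. ennreal ((F p)\<^sup>2) * indicator ?R p \<partial>lborel)
     \<le> (\<integral>\<^sup>+p. (ennreal ((F p)\<^sup>2) * indicator {-1..1} (snd p)) * indicator ({0..1} \<times> UNIV) p \<partial>lborel)"
    by (intro nn_integral_mono) (auto simp: indicator_def)
  also have "\<dots> = (\<integral>\<^sup>+p. (ennreal ((F (area_map p))\<^sup>2) * indicator {-1..1} (snd (area_map p))) * ennreal (2 * fst p) * indicator ({0..1} \<times> UNIV) p \<partial>lborel)"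
    by (rule nn_integral_area_map) measurable
  also have "\<dots> \<le> (\<integral>\<^sup>+p. 2 * (ennreal ((F (area_map p))\<^sup>2) * indicator Omega p) \<partial>lborel)"
  proof (intro nn_integral_mono)
    fix p :: "real \<times> real"
    show "(ennreal ((F (area_map p))\<^sup>2) * indicator {-1..1} (snd (area_map p))) * ennreal (2 * fst p) * indicator ({0..1} \<times> UNIV) p
        \<le> 2 * (ennreal ((F (area_map p))\<^sup>2) * indicator Omega p)"
    proof (cases "p \<in> Omega")
      case True
      \<comment> \<open>The Jacobian of \<open>t = x\<^sup>2\<close> is at most 2.\<close>
      then have "ennreal (2 * fst p) \<le> ennreal 2" by (intro ennreal_leI) (auto simp: Omega_def)
      then have "ennreal ((F (area_map p))\<^sup>2) * ennreal (2 * fst p) \<le> ennreal ((F (area_map p))\<^sup>2) * 2"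
        by (intro mult_left_mono) auto
      then show ?thesis using True by (cases p) (auto simp: Omega_def area_map_def mult.commute)
    next
      case False
      then have "indicator {-1..1} (snd (area_map p)) = (0 :: ennreal) \<or> indicator ({0..1} \<times> UNIV) p = (0 :: ennreal)"
        by (cases p) (auto simp: Omega_def area_map_def indicator_def)
      then show ?thesis by (elim disjE) simp_all
    qed
  qed
  also have "\<dots> = 2 * ennreal c" unfolding c_nn[symmetric] by (rule nn_integral_cmult) measurable
  also have "\<dots> = ennreal (2 * c)" using c0 by (simp add: ennreal_mult')
  finally have \<Phi>: "(\<integral>\<^sup>+p. ennreal ((F p)\<^sup>2) * indicator ?R p \<partial>lborel) \<le> ennreal (2 * c)" .
  define N where "N = (\<integral>p. (v p)\<^sup>2 \<partial>lborel)"
  have N: "N \<le> 4 * (M * T) powr (2/3) * (2 * c) powr (1/3)"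
    unfolding N_def using \<Phi> c0 by (intro squared_L2_le_abel) auto
  have N0: "0 \<le> N" unfolding N_def by (intro Bochner_Integration.integral_nonneg) auto

  let ?w = "\<lambda>p :: real \<times> real \<times> real. v ((fst p)\<^sup>2 + (fst (snd p))\<^sup>2, snd (snd p))"
  have cylB: "cylinder \<in> sets borel"
  proof -
    have "cylinder = {p. (fst p)\<^sup>2 + (fst (snd p))\<^sup>2 \<le> 1} \<inter> {p. - 1 \<le> snd (snd p)} \<inter> {p. snd (snd p) \<le> 1}"
      by (auto simp: cylinder_def)
    moreover have "closed \<dots>" by (intro closed_Int closed_Collect_le continuous_intros)
    ultimately show ?thesis by (metis borel_closed)
  qed
  have wB: "?w \<in> borel_measurable borel"
  proof -
    have "?w \<in> borel_measurable (borel \<Otimes>\<^sub>M borel \<Otimes>\<^sub>M borel)" by measurable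
    then show ?thesis by (simp add: borel_prod)
  qed
  have w_nn: "(\<integral>\<^sup>+p. ennreal ((?w p)\<^sup>2) * indicator cylinder p \<partial>lborel) = ennreal (pi * N)"
  proof -
    have "(\<integral>\<^sup>+p. ennreal ((?w p)\<^sup>2) * indicator cylinder p \<partial>lborel)
       = (\<integral>\<^sup>+p. ennreal ((?w p)\<^sup>2) * indicator {..1} ((fst p)\<^sup>2 + (fst (snd p))\<^sup>2) \<partial>lborel)"
    proof (intro nn_integral_cong)
      fix p :: "real \<times> real \<times> real"
      show "ennreal ((?w p)\<^sup>2) * indicator cylinder p = ennreal ((?w p)\<^sup>2) * indicator {..1} ((fst p)\<^sup>2 + (fst (snd p))\<^sup>2)"
        using v_support[of "((fst p)\<^sup>2 + (fst (snd p))\<^sup>2, snd (snd p))"]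
        by (cases p) (auto simp: cylinder_def indicator_def)
    qed
    also have "\<dots> = ennreal pi * (\<integral>\<^sup>+p. ennreal ((v p)\<^sup>2) * indicator ({0..1} \<times> UNIV) p \<partial>lborel)"
      by (rule nn_integral_cylinder) measurable
    also have "(\<integral>\<^sup>+p. ennreal ((v p)\<^sup>2) * indicator ({0..1} \<times> UNIV) p \<partial>lborel) = (\<integral>\<^sup>+p. ennreal ((v p)\<^sup>2) \<partial>lborel)"
    proof (intro nn_integral_cong)
      show "ennreal ((v p)\<^sup>2) * indicator ({0..1} \<times> UNIV) p = ennreal ((v p)\<^sup>2)" for p
        using v_support[of p] by (cases "p \<in> ?R") auto
    qed
    also have "\<dots> = ennreal N"
      unfolding N_def
    proof (intro nn_integral_eq_integral)
      show "integrable lborel (\<lambda>p. (v p)\<^sup>2)"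
      proof (rule integrable_bounded_of_bounded_support[OF _ _ compact_Omega])
        show "\<bar>(v p)\<^sup>2\<bar> \<le> M\<^sup>2" for p using power_mono[OF v_bounded[of p], of 2] by simp
      qed (auto simp: v_outside_Omega)
    qed auto
    finally show ?thesis by (simp add: ennreal_mult')
  qed
  have u_AE: "AE p in lborel. p \<in> cylinder \<longrightarrow> u p = ?w p"
    by (rule axisymmetric_AE[OF axi g_def])
  have piN: "0 \<le> pi * N" using N0 by simp
  note u_L2 = L2_of_AE_eq_borel[OF cylB wB u_AE w_nn piN]

  have "L2_norm cylinder u \<le> 6 * M powr (1/3) * T powr (1/3) * L2_norm Omega f powr (1/3)"
  proof (rule power2_le_imp_le)
    have sq: "(x powr (1/3))\<^sup>2 = x powr (2/3)" for x :: real
      by (simp add: power2_eq_square flip: powr_add)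
    have "(L2_norm cylinder u)\<^sup>2 = pi * N" using u_L2(2) piN by simp
    also have "\<dots> \<le> 4 * (4 * (M * T) powr (2/3) * (2 * c) powr (1/3))"
      using N N0 pi_less_4 by (intro mult_mono) auto
    also have "(2 * c) powr (1/3) = 2 powr (1/3) * c powr (1/3)"
      using c0 by (simp add: powr_mult)
    also have "4 * (4 * (M * T) powr (2/3) * (2 powr (1/3) * c powr (1/3)))
        = 2 powr (1/3) * (16 * ((M * T) powr (2/3) * c powr (1/3)))" by simp
    also have "\<dots> \<le> 2 * (16 * ((M * T) powr (2/3) * c powr (1/3)))"
      using powr_mono[of "1/3" 1 "2::real"] by (intro mult_right_mono) auto
    also have "\<dots> \<le> 36 * ((M * T) powr (2/3) * c powr (1/3))" by simp
    also have "(M * T) powr (2/3) = M powr (2/3) * T powr (2/3)"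
      using M_nonneg T_nonneg by (simp add: powr_mult)
    also have "c powr (1/3) = (sqrt c) powr (2/3)"
      using c0 by (simp add: powr_half_sqrt[symmetric] powr_powr)
    also have "36 * (M powr (2/3) * T powr (2/3) * (sqrt c) powr (2/3))
        = (6 * M powr (1/3) * T powr (1/3) * L2_norm Omega f powr (1/3))\<^sup>2"
      by (simp add: power_mult_distrib sq f_L2(2))
    finally show "(L2_norm cylinder u)\<^sup>2 \<le> (6 * M powr (1/3) * T powr (1/3) * L2_norm Omega f powr (1/3))\<^sup>2" .
  qed simp
  with u_L2(1) f_L2(1) show "L2_on cylinder u \<and> L2_on Omega f \<and>
      L2_norm cylinder u \<le> 6 * Linf_norm Omega (profile u) powr (1/3) * TV_norm (profile u) powr (1/3)
          * L2_norm Omega f powr (1/3)"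
    unfolding M_def T_def g_def by blast
qed

end
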